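(* Let $n\geq 2$ and $k\geq 1$, and let $c^{(k)}_n(x)=\sum_{\pi\in\widetilde{\mathcal{Q}}_n(k)}x^{\mathrm{ap}(\pi)}$. Then $$c^{(k)}_{n}(x)=\sum_{T\in \mathcal{T}_{n}(k)}x^{\mathrm{lleaf}(T)}=\sum_{i=1}^{\lfloor n/2\rfloor} \widetilde{\gamma}_{n,k,i}\,x^i(1+x)^{n-2i},$$ where $\widetilde{\gamma}_{n,k,i}$ is the number of trees in $\mathcal{T}_n(k)$ with exactly $i$ labeled leaves and no young leaves.
   Context: A $k$-Stirling permutation of order $n$ is a word $\pi=\pi_1\cdots\pi_{kn}$ in which each of $1,\dots,n$ appears exactly $k$ times, such that $\pi_i=\pi_l$ with $i<l$ implies $\pi_j\geq\pi_i$ for all $i<j<l$. $\widetilde{\mathcal{Q}}_n(k)$ is the set of those with $\pi_1=1$. An index $i$ is a longest ascent-plateau of $\pi$ if $\pi_i<\pi_{i+1}=\cdots=\pi_{i+k}$; $\mathrm{ap}(\pi)$ is the number of them. Trees: all trees are ordered (plane) rooted trees; the level of a node is its distance from the root (root at level 0); a leaf is a node with no children. An even $k$-ary tree is an ordered tree in which every node on an even level has exactly $k$ children. A pruned even $k$-ary tree is obtained from an even $k$-ary tree by deleting, for every even-level node all of whose children are leaves, all those children. An increasing pruned even $k$-ary tree on $[n]$ is a pruned even $k$-ary tree whose nodes on even levels are labeled bijectively by $[n]$ (odd-level nodes unlabeled) such that labels increase along every path from the root downward and, for each node, the labels of its children increase from left to right; $\mathcal{T}_n(k)$ is the set of them.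 A labeled leaf is a leaf on an even level; $\mathrm{lleaf}(T)$ is the number of labeled leaves. For a labeled node $v$, its grand parent is the labeled node $u$ such that a child of $u$ is the parent of $v$. A labeled non-root node is old if its label is the greatest among all grand children of its grand parent, and young otherwise; the root is neither. A young leaf is a young labeled leaf. *)

theory Defs
  imports "HOL-Computational_Algebra.Polynomial"
begin

text \<open>Words are lists; the letter \<open>\<pi>\<^sub>i\<close> is \<open>w ! (i - 1)\<close>.\<close>

definition stirling_perm :: "nat \<Rightarrow> nat \<Rightarrow> nat list \<Rightarrow> bool" where
  "stirling_perm k n w \<longleftrightarrow>
     length w = k * n \<and>
     (\<forall>m\<in>{1..n}. count_list w m = k) \<and>
     (\<forall>i j l. i < j \<and> j < l \<and> l < length w \<and> w ! i = w ! l \<longrightarrow> w ! j \<ge> w ! i)"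

definition Qtilde :: "nat \<Rightarrow> nat \<Rightarrow> nat list set" where
  "Qtilde k n = {w. stirling_perm k n w \<and> w ! 0 = 1}"

definition longest_ascent_plateau :: "nat \<Rightarrow> nat list \<Rightarrow> nat \<Rightarrow> bool" where
  "longest_ascent_plateau k w i \<longleftrightarrow>
     i + k < length w \<and> w ! i < w ! (i + 1) \<and> (\<forall>j\<in>{1..k}. w ! (i + j) = w ! (i + 1))"

definition ap :: "nat \<Rightarrow> nat list \<Rightarrow> nat" where
  "ap k w = card {i. longest_ascent_plateau k w i}"

definition c_poly :: "nat \<Rightarrow> nat \<Rightarrow> int poly" where
  "c_poly k n = (\<Sum>w\<in>Qtilde k n. monom 1 (ap k w))"

text \<open>
  A node of an ordered tree is addressed by the list of child positions (counted from 0) on the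
  path from the root to it, so its level is the length of its address.
\<close>

datatype 'a otree = Node (root_label: 'a) (children: "'a otree list")

fun is_node :: "'a otree \<Rightarrow> nat list \<Rightarrow> bool" where
  "is_node t [] \<longleftrightarrow> True"
| "is_node t (i # p) \<longleftrightarrow> i < length (children t) \<and> is_node (children t ! i) p"

definition nodes :: "'a otree \<Rightarrow> nat list set" where
  "nodes t = {p. is_node t p}"

text \<open>The subtree rooted at the node \<open>p\<close>; only meaningful for \<open>p \<in> nodes t\<close>.\<close>

fun subtree :: "'a otree \<Rightarrow> nat list \<Rightarrow> 'a otree" where
  "subtree t [] = t"
| "subtree t (i # p) = subtree (children t ! i) p"

abbreviation level :: "nat list \<Rightarrow> nat" where
  "level p \<equiv> length p"

definition is_leaf :: "'a otree \<Rightarrow> nat list \<Rightarrow> bool" where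
  "is_leaf t p \<longleftrightarrow> children (subtree t p) = []"

definition even_kary :: "nat \<Rightarrow> 'a otree \<Rightarrow> bool" where
  "even_kary k t \<longleftrightarrow>
     (\<forall>p\<in>nodes t. even (level p) \<longrightarrow> length (children (subtree t p)) = k)"

text \<open>\<open>prune_at l\<close> prunes a subtree whose root is at level \<open>l\<close> of the whole tree.\<close>

fun prune_at :: "nat \<Rightarrow> 'a otree \<Rightarrow> 'a otree" where
  "prune_at l (Node a ts) =
     Node a (if even l \<and> (\<forall>t\<in>set ts. children t = []) then []
             else map (prune_at (Suc l)) ts)"

definition prune :: "'a otree \<Rightarrow> 'a otree" where
  "prune = prune_at 0"

definition pruned_even_kary :: "nat \<Rightarrow> unit otree \<Rightarrow> bool" where
  "pruned_even_kary k s \<longleftrightarrow> (\<exists>t. even_kary k t \<and> s = prune t)"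

text \<open>Partially labeled trees have type \<open>nat option otree\<close>, with \<open>None\<close> on unlabeled nodes.\<close>

definition shape :: "'a otree \<Rightarrow> unit otree" where
  "shape = map_otree (\<lambda>_. ())"

definition node_label :: "nat option otree \<Rightarrow> nat list \<Rightarrow> nat option" where
  "node_label T p = root_label (subtree T p)"

abbreviation lab :: "nat option otree \<Rightarrow> nat list \<Rightarrow> nat" where
  "lab T p \<equiv> the (node_label T p)"

definition labeled_nodes :: "nat option otree \<Rightarrow> nat list set" where
  "labeled_nodes T = {p \<in> nodes T. even (level p)}"

text \<open>The set of increasing pruned even \<open>k\<close>-ary trees on \<open>{1..n}\<close>.\<close>

definition inc_trees :: "nat \<Rightarrow> nat \<Rightarrow> nat option otree set" where
  "inc_trees k n = {T.
     pruned_even_kary k (shape T) \<and>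
     (\<forall>p\<in>nodes T. odd (level p) \<longrightarrow> node_label T p = None) \<and>
     bij_betw (node_label T) (labeled_nodes T) (Some ` {1..n}) \<and>
     (\<forall>p q. p \<in> labeled_nodes T \<and> p @ q \<in> labeled_nodes T \<and> q \<noteq> []
        \<longrightarrow> lab T p < lab T (p @ q)) \<and>
     (\<forall>p i j. i < j \<and> p @ [i] \<in> labeled_nodes T \<and> p @ [j] \<in> labeled_nodes T
        \<longrightarrow> lab T (p @ [i]) < lab T (p @ [j]))}"

definition labeled_leaves :: "nat option otree \<Rightarrow> nat list set" where
  "labeled_leaves T = {p \<in> labeled_nodes T. is_leaf T p}"

definition lleaf :: "nat option otree \<Rightarrow> nat" where
  "lleaf T = card (labeled_leaves T)"

definition grand_parent :: "nat list \<Rightarrow> nat list" where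
  "grand_parent p = butlast (butlast p)"

definition grand_children :: "nat option otree \<Rightarrow> nat list \<Rightarrow> nat list set" where
  "grand_children T p = {q \<in> nodes T. \<exists>i j. q = p @ [i, j]}"

definition old :: "nat option otree \<Rightarrow> nat list \<Rightarrow> bool" where
  "old T p \<longleftrightarrow> p \<in> labeled_nodes T \<and> p \<noteq> [] \<and>
     (\<forall>q\<in>grand_children T (grand_parent p). lab T q \<le> lab T p)"

definition young :: "nat option otree \<Rightarrow> nat list \<Rightarrow> bool" where
  "young T p \<longleftrightarrow> p \<in> labeled_nodes T \<and> p \<noteq> [] \<and> \<not> old T p"

definition young_leaves :: "nat option otree \<Rightarrow> nat list set" where
  "young_leaves T = {p \<in> labeled_leaves T. young T p}"

definition gamma_tilde :: "nat \<Rightarrow> nat \<Rightarrow> nat \<Rightarrow> nat" where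
  "gamma_tilde n k i = card {T \<in> inc_trees k n. lleaf T = i \<and> young_leaves T = {}}"

end

theory Submission
  imports Defs "HOL-Library.FuncSet"
begin

text \<open>
  Both sides grow by inserting the largest label. A word of order \<open>m\<close> has \<open>k * m\<close> gaps for the
  block of \<open>m + 1\<close>; the block always forms a new plateau, and it destroys an old one exactly in the
  \<open>k\<close> gaps belonging to that plateau. A tree on \<open>m\<close> labels has \<open>k * m\<close> places for the new leaf, and it
  destroys an old leaf exactly in the \<open>k\<close> places below that leaf. So plateaus and leaves obey the same
  recursion, stated for sums of an arbitrary function of the statistic, and they agree for \<open>n = 2\<close>.

  For the expansion, let \<open>i\<close> and \<open>j\<close> be the numbers of old and young leaves. Inserting \<open>m + 1\<close> below a
  node \<open>u\<close> changes \<open>(i, j)\<close> into \<open>(i, j)\<close> if \<open>u\<close> is an old leaf, \<open>(i + 1, j - 1)\<close> if it is a young leaf,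
  \<open>(i, j + 1)\<close> if it is internal and its greatest grand child is a leaf (\<open>i\<close> such nodes), and
  \<open>(i + 1, j)\<close> for the other \<open>m - 2 * i - j\<close> nodes. Inductively, the number of trees with statistic
  \<open>(i, j)\<close> is a binomial coefficient \<open>n - 2 * i\<close> over \<open>j\<close> times a factor depending only on \<open>i\<close>; \<open>j = 0\<close>
  identifies that factor.
\<close>

section \<open>Stirling permutations\<close>

definition insert_block :: "nat \<Rightarrow> nat \<Rightarrow> nat list \<Rightarrow> nat \<Rightarrow> nat list" where
  "insert_block k N w p = take p w @ replicate k N @ drop p w"

lemma length_insert_block [simp]: "length (insert_block k N w p) = length w + k"
  by (simp add: insert_block_def)

lemma nth_insert_block:
  assumes "p \<le> length w" "i < length w + k"
  shows "insert_block k N w p ! i =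
    (if i < p then w ! i else if i < p + k then N else w ! (i - k))"
  using assms by (auto simp: insert_block_def nth_append)

lemma count_list_replicate [simp]: "count_list (replicate k x) y = (if x = y then k else 0)"
  by (induction k) auto

lemma count_list_insert_block:
  "count_list (insert_block k N w p) y = count_list w y + (if y = N then k else 0)"
proof -
  have "count_list w y = count_list (take p w) y + count_list (drop p w) y"
    by (metis append_take_drop_id count_list_append)
  then show ?thesis by (simp add: insert_block_def)
qed

text \<open>The prescribed counts of \<open>1\<close> to \<open>n\<close> already add up to the
  length \<open>k * n\<close>, so no position is left for any other letter.\<close>

lemma stirling_perm_set:
  assumes "stirling_perm k n w"
  shows "set w \<subseteq> {1..n}"
proof (rule ccontr)
  assume "\<not> set w \<subseteq> {1..n}"
  then obtain x where x: "x \<in> set w" "x \<notin> {1..n}" by blast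
  have "length w = (\<Sum>y\<in>set w \<union> {1..n}. count_list w y)"
    by (rule sum_count_set[symmetric]) auto
  also have "\<dots> = (\<Sum>y\<in>{1..n}. count_list w y) + (\<Sum>y\<in>set w - {1..n}. count_list w y)"
    by (subst sum.union_disjoint[symmetric]) (auto intro!: sum.cong)
  also have "(\<Sum>y\<in>{1..n}. count_list w y) = k * n"
    using assms by (simp add: stirling_perm_def)
  finally have "(\<Sum>y\<in>set w - {1..n}. count_list w y) = 0"
    using assms by (simp add: stirling_perm_def)
  with x show False by (simp add: count_list_0_iff)
qed

lemma stirling_perm_nth_le:
  assumes "stirling_perm k n w" "i < length w"
  shows "w ! i \<le> n"
  using stirling_perm_set[OF assms(1)] nth_mem[OF assms(2)] by auto

text \<open>Two equal letters with something between them either both lie outside the block, where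
  the condition is inherited from \<open>w\<close> or the enclosed letter is the maximal
  \<open>Suc m\<close>, or both belong to the block, which is contiguous.\<close>

lemma stirling_perm_insert_block:
  assumes w: "stirling_perm k m w" and p: "p \<le> length w"
  shows "stirling_perm k (Suc m) (insert_block k (Suc m) w p)" (is "stirling_perm _ _ ?v")
proof -
  have len: "length w = k * m" and cnt: "\<And>x. x \<in> {1..m} \<Longrightarrow> count_list w x = k"
    and st: "\<And>i j l. i < j \<Longrightarrow> j < l \<Longrightarrow> l < length w \<Longrightarrow> w ! i = w ! l \<Longrightarrow> w ! j \<ge> w ! i"
    using w unfolding stirling_perm_def by blast+
  have small: "w ! i < Suc m" if "i < length w" for i
    using stirling_perm_nth_le[OF w that] by simp
  have "Suc m \<notin> set w" using stirling_perm_set[OF w] by auto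
  then have cN: "count_list w (Suc m) = 0" by (simp add: count_list_0_iff)
  have "?v ! j \<ge> ?v ! i" if h: "i < j" "j < l" "l < length ?v" "?v ! i = ?v ! l" for i j l
  proof (cases "p \<le> j \<and> j < p + k")
    case True
    then have "?v ! j = Suc m" using h p by (simp add: nth_insert_block)
    moreover have "?v ! i \<le> Suc m"
      using True h(1-3) p small[of i] by (auto simp: nth_insert_block)
    ultimately show ?thesis by simp
  next
    case jout: False
    \<comment> \<open>Translates positions of the new word outside the block back to positions of
      \<open>w\<close>.\<close>
    define r where "r a = (if a < p then a else a - k)" for a
    have out: "?v ! a = w ! r a \<and> r a < length w" if "\<not> (p \<le> a \<and> a < p + k)" "a < length ?v" for a
      using that p by (auto simp: nth_insert_block r_def)
    have inN: "?v ! a = Suc m" if "p \<le> a \<and> a < p + k" "a < length ?v" for a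
      using that p by (simp add: nth_insert_block)
    have io: "\<not> (p \<le> i \<and> i < p + k)"
    proof
      assume i: "p \<le> i \<and> i < p + k"
      then have "\<not> (p \<le> l \<and> l < p + k)" using jout h by auto
      then show False using inN[of i] out[of l] small[of "r l"] i h by auto
    qed
    have lo: "\<not> (p \<le> l \<and> l < p + k)"
      using inN[of l] out[of i] small[of "r i"] io h by force
    have "r i < r j" "r j < r l" using io jout lo h(1,2) by (auto simp: r_def)
    then show ?thesis using st[of "r i" "r j" "r l"] out[of i] out[of j] out[of l] io jout lo h by auto
  qed
  moreover have "count_list ?v x = k" if "x \<in> {1..Suc m}" for x
    using that cnt[of x] cN by (auto simp: count_list_insert_block le_Suc_eq)
  ultimately show ?thesis using len by (auto simp: stirling_perm_def)
qed

lemma stirling_perm_remove_block: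
  assumes v: "stirling_perm k (Suc m) (insert_block k (Suc m) w p)" (is "stirling_perm _ _ ?v")
    and p: "p \<le> length w"
  shows "stirling_perm k m w"
proof -
  define r where "r a = (if a < p then a else a + k)" for a
  have r: "?v ! r a = w ! a \<and> r a < length ?v" if "a < length w" for a
    using that p by (auto simp: nth_insert_block r_def)
  have mono: "r a < r b" if "a < b" for a b using that by (auto simp: r_def)
  have st: "\<And>i j l. i < j \<Longrightarrow> j < l \<Longrightarrow> l < length ?v \<Longrightarrow> ?v ! i = ?v ! l \<Longrightarrow> ?v ! j \<ge> ?v ! i"
    using v unfolding stirling_perm_def by blast
  have "w ! j \<ge> w ! i" if h: "i < j" "j < l" "l < length w" "w ! i = w ! l" for i j l
    using st[of "r i" "r j" "r l"] mono[of i j] mono[of j l] r[of i] r[of j] r[of l] h by auto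
  moreover have "count_list w x = k" if "x \<in> {1..m}" for x
  proof -
    have "count_list ?v x = k" using v that unfolding stirling_perm_def by auto
    then show ?thesis using that by (auto simp: count_list_insert_block split: if_splits)
  qed
  moreover have "length w = k * m" using v by (auto simp: stirling_perm_def)
  ultimately show ?thesis by (auto simp: stirling_perm_def)
qed

text \<open>A letter enclosed by two copies of the greatest letter is at least as large, hence equal
  to it. So the copies of \<open>Suc m\<close> occupy consecutive positions.\<close>

lemma stirling_perm_block_exists:
  assumes v: "stirling_perm k (Suc m) v" and k: "k \<ge> 1"
  obtains w p where "p \<le> length w" "v = insert_block k (Suc m) w p"
proof -
  define S where "S = {i. i < length v \<and> v ! i = Suc m}"
  have len: "length v = k * Suc m" and "count_list v (Suc m) = k"
    and st: "\<And>i j l. i < j \<Longrightarrow> j < l \<Longrightarrow> l < length v \<Longrightarrow> v ! i = v ! l \<Longrightarrow> v ! j \<ge> v ! i"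
    using v unfolding stirling_perm_def by (blast, simp, blast)
  then have cS: "card S = k"
    by (simp add: count_list_eq_length_filter length_filter_conv_card S_def eq_commute)
  have fin: "finite S" by (simp add: S_def)
  have ne: "S \<noteq> {}" using cS k by auto
  define p where "p = Min S"
  have S: "S = {p..Max S}"
  proof
    show "S \<subseteq> {p..Max S}" using fin by (auto simp: p_def)
    show "{p..Max S} \<subseteq> S"
    proof
      fix j assume j: "j \<in> {p..Max S}"
      have a: "p \<in> S" "Max S \<in> S" using fin ne by (auto simp: p_def)
      show "j \<in> S"
      proof (cases "j = p \<or> j = Max S")
        case True then show ?thesis using a by auto
      next
        case False
        then have h: "p < j" "j < Max S" using j by auto
        have "v ! j \<ge> Suc m" using st[OF h] a by (auto simp: S_def)
        moreover have "j < length v" using h a by (auto simp: S_def)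
        ultimately show ?thesis using stirling_perm_nth_le[OF v, of j] by (auto simp: S_def)
      qed
    qed
  qed
  moreover have "p \<le> Max S" using fin ne by (simp add: p_def)
  moreover have "card S = Suc (Max S) - p" by (subst S) simp
  ultimately have "Suc (Max S) = p + k" using cS by simp
  then have S': "S = {p..<p+k}" by (subst S) auto
  have "Max S \<in> S" using fin ne by simp
  then have Sl: "p + k \<le> length v" using \<open>Suc (Max S) = p + k\<close> by (auto simp: S_def)
  define w where "w = take p v @ drop (p + k) v"
  have "p \<le> length w" using Sl by (simp add: w_def)
  moreover have "v = insert_block k (Suc m) w p"
  proof (rule nth_equalityI)
    show "length v = length (insert_block k (Suc m) w p)" using Sl by (simp add: w_def)
    fix i assume i: "i < length v"
    show "v ! i = insert_block k (Suc m) w p ! i"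
    proof (cases "p \<le> i \<and> i < p + k")
      case True
      then have "i \<in> S" using S' by auto
      then show ?thesis using True i Sl by (auto simp: S_def nth_insert_block w_def)
    next
      case False
      then show ?thesis using i Sl by (auto simp: nth_insert_block w_def nth_append)
    qed
  qed
  ultimately show thesis using that by blast
qed

text \<open>Gap \<open>0\<close> is left out because it would put \<open>Suc m\<close> in front of
  the leading \<open>1\<close>. The gap can be recovered from the result as the first position of
  \<open>Suc m\<close>.\<close>

lemma bij_betw_insert_block:
  assumes m: "m \<ge> 1" and k: "k \<ge> 1"
  shows "bij_betw (\<lambda>(w, p). insert_block k (Suc m) w p) (Qtilde k m \<times> {1..k * m}) (Qtilde k (Suc m))"
proof -
  \<comment> \<open>If \<open>p < q\<close>, position \<open>p\<close> holds \<open>Suc m\<close> in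
    one word and a letter of \<open>v\<close>, at most \<open>m\<close>, in the other.\<close>
  have le: "q \<le> p" if "insert_block k (Suc m) w p = insert_block k (Suc m) v q"
    "w \<in> Qtilde k m" "v \<in> Qtilde k m" "p \<le> k * m" "q \<le> k * m" for w v p q
  proof (rule ccontr)
    assume "\<not> q \<le> p"
    then have pq: "p < q" by simp
    have len: "length w = k * m" "length v = k * m" using that by (auto simp: Qtilde_def stirling_perm_def)
    have "insert_block k (Suc m) w p ! p = Suc m" using that(2-) len k by (simp add: nth_insert_block)
    moreover have "insert_block k (Suc m) v q ! p = v ! p" using that(2-) len pq by (simp add: nth_insert_block)
    moreover have "v ! p \<le> m" using that pq len by (intro stirling_perm_nth_le[of k]) (auto simp: Qtilde_def)
    ultimately show False using that(1) by simp
  qed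
  have inj: "w = v \<and> p = q" if "insert_block k (Suc m) w p = insert_block k (Suc m) v q"
    "w \<in> Qtilde k m" "v \<in> Qtilde k m" "p \<le> k * m" "q \<le> k * m" for w v p q
  proof -
    have pq: "p = q" using le[of w p v q] le[of v q w p] that by simp
    have len: "length w = k * m" "length v = k * m" using that by (auto simp: Qtilde_def stirling_perm_def)
    have "take p w = take p v \<and> drop p w = drop p v"
      using that(1) len pq by (simp add: insert_block_def)
    then have "w = v" by (metis append_take_drop_id)
    then show ?thesis using pq by simp
  qed
  have img: "insert_block k (Suc m) w p \<in> Qtilde k (Suc m)" if "w \<in> Qtilde k m" "p \<in> {1..k * m}" for w p
  proof -
    have len: "length w = k * m" using that by (auto simp: Qtilde_def stirling_perm_def)
    then show ?thesis using that stirling_perm_insert_block[of k m w p]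
      nth_insert_block[of p w 0 k "Suc m"] m k by (auto simp: Qtilde_def)
  qed
  have surj: "\<exists>w p. w \<in> Qtilde k m \<and> p \<in> {1..k * m} \<and> v = insert_block k (Suc m) w p"
    if v: "v \<in> Qtilde k (Suc m)" for v
  proof -
    from v have sv: "stirling_perm k (Suc m) v" and v0: "v ! 0 = 1" by (auto simp: Qtilde_def)
    obtain w p where wp: "p \<le> length w" "v = insert_block k (Suc m) w p"
      using stirling_perm_block_exists[OF sv k] by blast
    have sw: "stirling_perm k m w" using stirling_perm_remove_block sv wp by blast
    then have len: "length w = k * m" by (simp add: stirling_perm_def)
    have "v ! 0 = (if 0 < p then w ! 0 else Suc m)"
      using nth_insert_block[of p w 0 k "Suc m"] wp k by auto
    then have "p \<noteq> 0" "w ! 0 = 1" using v0 m by (auto split: if_splits)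
    then show ?thesis using sw wp \<open>p \<noteq> 0\<close> len by (intro exI[of _ w] exI[of _ p]) (auto simp: Qtilde_def)
  qed
  show ?thesis unfolding bij_betw_def
  proof
    show "inj_on (\<lambda>(w, p). insert_block k (Suc m) w p) (Qtilde k m \<times> {1..k * m})"
      using inj by (auto simp: inj_on_def)
    show "(\<lambda>(w, p). insert_block k (Suc m) w p) ` (Qtilde k m \<times> {1..k * m}) = Qtilde k (Suc m)"
      using img surj by (force simp: image_iff)
  qed
qed

lemma Qtilde_one:
  assumes "k \<ge> 1" shows "Qtilde k 1 = {replicate k 1}"
proof -
  have "w = replicate k 1" if "stirling_perm k 1 w" for w
  proof (rule replicate_eqI)
    show "length w = k" using that by (simp add: stirling_perm_def)
    show "y = 1" if "y \<in> set w" for y using stirling_perm_set[OF \<open>stirling_perm k 1 w\<close>] that by auto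
  qed
  moreover have "stirling_perm k 1 (replicate k 1)" by (auto simp: stirling_perm_def)
  ultimately have eq: "stirling_perm k 1 w \<longleftrightarrow> w = replicate k 1" for w by blast
  show ?thesis unfolding Qtilde_def eq using assms by auto
qed

section \<open>Effect of a block insertion on the longest ascent-plateaus\<close>

abbreviation plateaus :: "nat \<Rightarrow> nat list \<Rightarrow> nat set" where
  "plateaus k w \<equiv> {i. longest_ascent_plateau k w i}"

lemma finite_plateaus [simp]: "finite (plateaus k w)"
  by (rule finite_subset[of _ "{..<length w}"]) (auto simp: longest_ascent_plateau_def)

text \<open>The \<open>k\<close> letters after a plateau index are equal, so no ascent can start at
  one of them that is followed by another.\<close>

lemma plateaus_apart:
  assumes "i \<in> plateaus k w" "j \<in> plateaus k w" "i < j"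
  shows "i + k \<le> j"
proof (rule ccontr)
  assume "\<not> i + k \<le> j"
  then have "j - i \<in> {1..k}" "Suc j - i \<in> {1..k}" using assms(3) by auto
  moreover from assms(1) have "\<And>t. t \<in> {1..k} \<Longrightarrow> w ! (i + t) = w ! (i + 1)"
    by (simp add: longest_ascent_plateau_def)
  ultimately have "w ! (i + (j - i)) = w ! (i + (Suc j - i))" by metis
  then have "w ! j = w ! Suc j" using assms(3) by simp
  then show False using assms(2) by (simp add: longest_ascent_plateau_def)
qed

text \<open>The block creates the plateau \<open>p - 1\<close>, as its letter exceeds the one before
  it. An old plateau survives when its run ends before the block, and it survives shifted by
  \<open>k\<close> when its index lies behind the block.\<close>

lemma plateaus_insert_block:
  assumes k: "k \<ge> 1" and p: "1 \<le> p" "p \<le> length w" and small: "\<And>i. i < length w \<Longrightarrow> w ! i < N"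
  shows "plateaus k (insert_block k N w p) =
    insert (p - 1) ({i \<in> plateaus k w. i + k < p} \<union> (\<lambda>i. i + k) ` {i \<in> plateaus k w. p \<le> i})"
    (is "?L = insert _ (?A \<union> ?B)")
proof -
  let ?v = "insert_block k N w p"
  have nth: "?v ! i = (if i < p then w ! i else if i < p + k then N else w ! (i - k))"
    if "i < length w + k" for i using nth_insert_block[OF p(2) that] .
  have "i \<in> insert (p - 1) (?A \<union> ?B)" if i: "i \<in> ?L" for i
  proof -
    from i have l: "i + k < length w + k" and asc: "?v ! i < ?v ! (i + 1)"
      and eq: "\<And>j. j \<in> {1..k} \<Longrightarrow> ?v ! (i + j) = ?v ! (i + 1)"
      by (auto simp: longest_ascent_plateau_def)
    consider "i = p - 1" | "i + k < p" | "i + 1 < p" "p \<le> i + k" | "p \<le> i" "i < p + k" | "p + k \<le> i"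
      by linarith
    then show ?thesis
    proof cases
      case 1 then show ?thesis by simp
    next
      case 2
      have "longest_ascent_plateau k w i"
        unfolding longest_ascent_plateau_def
      proof (intro conjI ballI)
        show "w ! i < w ! (i + 1)" using asc 2 l k by (simp add: nth)
        show "w ! (i + j) = w ! (i + 1)" if "j \<in> {1..k}" for j
          using eq[OF that] that 2 l k by (simp add: nth)
      qed (use 2 p in auto)
      then show ?thesis using 2 by auto
    next
      \<comment> \<open>The block begins inside the run following \<open>i\<close>, which forces a
        letter of \<open>w\<close> to equal \<open>N\<close>.\<close>
      case 3
      then have "p - i \<in> {1..k}" by auto
      from eq[OF this] have "N = w ! (i + 1)" using 3 l k p by (simp add: nth)
      then show ?thesis using small[of "i + 1"] 3 p by auto
    next
      \<comment> \<open>An index inside the block carries the maximal letter, so it is no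
        ascent.\<close>
      case 4
      then have "?v ! i = N" using l by (simp add: nth)
      moreover have "?v ! (i + 1) \<le> N" using 4 l k p small[of "i + 1 - k"]
        by (auto simp: nth less_imp_le)
      ultimately show ?thesis using asc by simp
    next
      case 5
      have sh: "?v ! (i + j) = w ! (i - k + j)" if "j \<le> k" for j
        using that 5 l by (simp add: nth)
      have "longest_ascent_plateau k w (i - k)"
        unfolding longest_ascent_plateau_def
      proof (intro conjI ballI)
        show "w ! (i - k) < w ! (i - k + 1)" using asc sh[of 0] sh[of 1] k by simp
        show "w ! (i - k + j) = w ! (i - k + 1)" if "j \<in> {1..k}" for j
          using eq[OF that] that sh[of j] sh[of 1] k by simp
      qed (use 5 l in auto)
      then have "i - k + k \<in> ?B" using 5 by (intro imageI) auto
      then show ?thesis using 5 by simp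
    qed
  qed
  moreover have "p - 1 \<in> ?L"
  proof -
    have "?v ! (p - 1 + j) = N" if "j \<in> {1..k}" for j using that p by (auto simp: nth)
    then show ?thesis using p k small[of "p - 1"] by (simp add: longest_ascent_plateau_def nth)
  qed
  moreover have "i \<in> ?L" if "i \<in> ?A" for i
  proof -
    from that have i: "i + k < p" "longest_ascent_plateau k w i" by auto
    then have "longest_ascent_plateau k ?v i"
      using p k unfolding longest_ascent_plateau_def by (auto simp: nth)
    then show ?thesis by simp
  qed
  moreover have "i + k \<in> ?L" if "i \<in> plateaus k w" "p \<le> i" for i
  proof -
    have sh: "?v ! (i + k + j) = w ! (i + j)" if "i + j < length w" for j
      using that \<open>p \<le> i\<close> by (simp add: nth algebra_simps)
    then have "longest_ascent_plateau k ?v (i + k)"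
      using that sh[of 0] sh[of 1] k unfolding longest_ascent_plateau_def by auto
    then show ?thesis by simp
  qed
  ultimately show ?thesis by blast
qed

text \<open>The gaps \<open>i + 1\<close> to \<open>i + k\<close> are those that break the plateau
  \<open>i\<close>. No gap breaks two plateaus, so at most one is lost against the one
  created.\<close>

lemma ap_insert_block:
  assumes k: "k \<ge> 1" and p: "1 \<le> p" "p \<le> length w" and small: "\<And>i. i < length w \<Longrightarrow> w ! i < N"
  shows "ap k (insert_block k N w p) =
    (if p \<in> (\<Union>i\<in>plateaus k w. {i + 1..i + k}) then ap k w else Suc (ap k w))"
proof -
  \<comment> \<open>Plateaus entirely before the block, behind it, and broken by it.\<close>
  let ?A = "{i \<in> plateaus k w. i + k < p}" and ?B = "{i \<in> plateaus k w. p \<le> i}"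
    and ?C = "{i \<in> plateaus k w. i < p \<and> p \<le> i + k}"
  have fin: "finite ?A" "finite ?B" "finite ?C"
    by (rule finite_subset[OF _ finite_plateaus[of k w]], blast)+
  have cB: "card ((\<lambda>i. i + k) ` ?B) = card ?B" by (rule card_image) (simp add: inj_on_def)
  have "p - 1 \<notin> ?A \<union> (\<lambda>i. i + k) ` ?B" using k p by auto
  moreover have "plateaus k (insert_block k N w p) = insert (p - 1) (?A \<union> (\<lambda>i. i + k) ` ?B)"
    by (rule plateaus_insert_block) (use assms in auto)
  ultimately have "ap k (insert_block k N w p) = Suc (card (?A \<union> (\<lambda>i. i + k) ` ?B))"
    unfolding ap_def using fin by simp
  also have "card (?A \<union> (\<lambda>i. i + k) ` ?B) = card ?A + card ?B"
    by (subst card_Un_disjoint) (use fin cB in auto)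
  finally have 1: "ap k (insert_block k N w p) = Suc (card ?A + card ?B)" .
  have "plateaus k w = (?A \<union> ?B) \<union> ?C" by auto
  then have "ap k w = card ((?A \<union> ?B) \<union> ?C)" unfolding ap_def by (rule arg_cong)
  also have "\<dots> = card (?A \<union> ?B) + card ?C" by (rule card_Un_disjoint) (use fin in auto)
  also have "card (?A \<union> ?B) = card ?A + card ?B" by (rule card_Un_disjoint) (use fin in auto)
  finally have 2: "ap k w = card ?A + card ?B + card ?C" .
  show ?thesis
  proof (cases "p \<in> (\<Union>i\<in>plateaus k w. {i + 1..i + k})")
    case True
    then obtain i where i: "i \<in> ?C" by (auto simp: Suc_le_eq)
    have "j = i" if "j \<in> ?C" for j
      using plateaus_apart[of i k w j] plateaus_apart[of j k w i] i that
      by (cases i j rule: linorder_cases) auto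
    then have "?C = {i}" using i by blast
    then have "card ?C = 1" by simp
    then show ?thesis using 1 2 True by simp
  next
    case False
    then have "?C = {}" by auto
    then have "card ?C = 0" by simp
    then show ?thesis using 1 2 unfolding if_not_P[OF False] by simp
  qed
qed

text \<open>By \<open>plateaus_apart\<close> the sets of \<open>k\<close> gaps belonging to
  different plateaus are disjoint.\<close>

lemma card_plateau_gaps:
  "card (\<Union>i\<in>plateaus k w. {i + 1..i + k}) = k * ap k w"
proof -
  have "card (\<Union>i\<in>plateaus k w. {i + 1..i + k}) = (\<Sum>i\<in>plateaus k w. card {i + 1..i + k})"
  proof (rule card_UN_disjoint)
    show "\<forall>i\<in>plateaus k w. \<forall>j\<in>plateaus k w. i \<noteq> j \<longrightarrow> {i + 1..i + k} \<inter> {j + 1..j + k} = {}"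
    proof (intro ballI impI)
      fix i j assume "i \<in> plateaus k w" "j \<in> plateaus k w" "i \<noteq> j"
      then show "{i + 1..i + k} \<inter> {j + 1..j + k} = {}"
        using plateaus_apart[of i k w j] plateaus_apart[of j k w i]
        by (cases i j rule: linorder_cases) auto
    qed
  qed auto
  then show ?thesis by (simp add: ap_def)
qed

text \<open>Group the words by the word left after deleting the block of \<open>Suc m\<close>: of
  its \<open>k * m\<close> gaps, \<open>k * ap k w\<close> break a plateau and the others break
  none.\<close>

lemma sum_Qtilde_Suc:
  fixes g :: "nat \<Rightarrow> 'a::comm_semiring_1"
  assumes m: "m \<ge> 1" and k: "k \<ge> 1"
  shows "(\<Sum>v\<in>Qtilde k (Suc m). g (ap k v)) =
    (\<Sum>w\<in>Qtilde k m. of_nat (k * ap k w) * g (ap k w) + of_nat (k * (m - ap k w)) * g (Suc (ap k w)))"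
proof -
  have "(\<Sum>v\<in>Qtilde k (Suc m). g (ap k v)) =
      (\<Sum>(w, p)\<in>Qtilde k m \<times> {1..k * m}. g (ap k (insert_block k (Suc m) w p)))"
    by (subst sum.reindex_bij_betw[OF bij_betw_insert_block[OF m k], symmetric])
      (simp add: case_prod_unfold)
  also have "\<dots> = (\<Sum>w\<in>Qtilde k m. \<Sum>p\<in>{1..k * m}. g (ap k (insert_block k (Suc m) w p)))"
    by (rule sum.cartesian_product[symmetric])
  also have "\<dots> = (\<Sum>w\<in>Qtilde k m. of_nat (k * ap k w) * g (ap k w) + of_nat (k * (m - ap k w)) * g (Suc (ap k w)))"
  proof (rule sum.cong[OF refl])
    fix w assume "w \<in> Qtilde k m"
    then have w: "stirling_perm k m w" by (simp add: Qtilde_def)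
    then have len: "length w = k * m" by (simp add: stirling_perm_def)
    define U where "U = (\<Union>i\<in>plateaus k w. {i + 1..i + k})"
    have U: "U \<subseteq> {1..k * m}" using len by (auto simp: U_def longest_ascent_plateau_def)
    have "(\<Sum>p\<in>{1..k * m}. g (ap k (insert_block k (Suc m) w p))) =
        (\<Sum>p\<in>{1..k * m}. if p \<in> U then g (ap k w) else g (Suc (ap k w)))"
      using k len stirling_perm_nth_le[OF w]
      by (intro sum.cong) (auto simp: ap_insert_block less_Suc_eq_le U_def simp del: UN_iff)
    also have "\<dots> = (\<Sum>p\<in>{1..k * m} \<inter> {p. p \<in> U}. g (ap k w)) +
        (\<Sum>p\<in>{1..k * m} \<inter> - {p. p \<in> U}. g (Suc (ap k w)))"
      by (rule sum.If_cases) simp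
    also have "{1..k * m} \<inter> {p. p \<in> U} = U" using U by auto
    also have "{1..k * m} \<inter> - {p. p \<in> U} = {1..k * m} - U" by auto
    also have "(\<Sum>p\<in>U. g (ap k w)) + (\<Sum>p\<in>{1..k * m} - U. g (Suc (ap k w))) =
        of_nat (card U) * g (ap k w) + of_nat (k * m - card U) * g (Suc (ap k w))"
      using U by (simp add: card_Diff_subset finite_subset)
    also have "card U = k * ap k w" unfolding U_def by (rule card_plateau_gaps)
    finally show "(\<Sum>p\<in>{1..k * m}. g (ap k (insert_block k (Suc m) w p))) =
        of_nat (k * ap k w) * g (ap k w) + of_nat (k * (m - ap k w)) * g (Suc (ap k w))"
      by (simp only: diff_mult_distrib2)
  qed
  finally show ?thesis .
qed

text \<open>The only word of order one has no plateau, and each of its \<open>k\<close> gaps gives a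
  word with one.\<close>

lemma sum_Qtilde_two:
  fixes g :: "nat \<Rightarrow> 'a::comm_semiring_1"
  assumes k: "k \<ge> 1"
  shows "(\<Sum>v\<in>Qtilde k 2. g (ap k v)) = of_nat k * g 1"
proof -
  have "ap k (replicate k 1) = 0" by (auto simp: ap_def longest_ascent_plateau_def)
  then show ?thesis using sum_Qtilde_Suc[of 1 k g] Qtilde_one[OF k] k by (simp add: numeral_2_eq_2)
qed

section \<open>Encodings of increasing trees\<close>

text \<open>
  A tree is encoded by the function sending each non-root label \<open>v\<close> to the label of its grand parent
  and the position (from 0) of the unlabeled node between them; both are arbitrary, subject to
  the grand parent being smaller.
\<close>

definition encodings :: "nat \<Rightarrow> nat \<Rightarrow> (nat \<Rightarrow> nat \<times> nat) set" where
  "encodings k n = (\<Pi>\<^sub>E v\<in>{2..n}. {1..<v} \<times> {..<k})"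

text \<open>In the encoded tree these are the labels of the nodes that are not leaves.\<close>

definition inner :: "nat \<Rightarrow> (nat \<Rightarrow> nat \<times> nat) \<Rightarrow> nat set" where
  "inner n f = (\<lambda>v. fst (f v)) ` {2..n}"

text \<open>The range starts at \<open>2\<close> because the root label \<open>1\<close> counts
  neither as young nor as old.\<close>

definition young_leaf_labels :: "nat \<Rightarrow> (nat \<Rightarrow> nat \<times> nat) \<Rightarrow> nat set" where
  "young_leaf_labels n f =
     {v \<in> {2..n}. v \<notin> inner n f \<and> (\<exists>w\<in>{2..n}. fst (f w) = fst (f v) \<and> v < w)}"

definition old_leaf_labels :: "nat \<Rightarrow> (nat \<Rightarrow> nat \<times> nat) \<Rightarrow> nat set" where
  "old_leaf_labels n f =
     {v \<in> {2..n}. v \<notin> inner n f \<and> (\<forall>w\<in>{2..n}. fst (f w) = fst (f v) \<longrightarrow> w \<le> v)}"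

lemma finite_leaf_labels [simp]:
  "finite (young_leaf_labels n f)" "finite (old_leaf_labels n f)"
  by (simp_all add: young_leaf_labels_def old_leaf_labels_def)

lemma finite_encodings [simp]: "finite (encodings k n)"
  by (simp add: encodings_def finite_PiE)

lemma encodings_apply:
  assumes "f \<in> encodings k n" "v \<in> {2..n}"
  shows "1 \<le> fst (f v)" "fst (f v) < v" "snd (f v) < k"
proof -
  have "f v \<in> {1..<v} \<times> {..<k}" using assms unfolding encodings_def by (rule PiE_mem)
  then show "1 \<le> fst (f v)" "fst (f v) < v" "snd (f v) < k" by auto
qed

lemma inner_subset:
  assumes "f \<in> encodings k n" shows "inner n f \<subseteq> {1..n}"
  using encodings_apply[OF assms] by (fastforce simp: inner_def)

text \<open>The constraint on \<open>f v\<close> involves \<open>v\<close> only, so an encoding on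
  \<open>Suc m\<close> labels is one on \<open>m\<close> labels together with a free choice of the
  value at \<open>Suc m\<close>.\<close>

lemma sum_encodings_Suc:
  assumes m: "m \<ge> 1"
  shows "(\<Sum>f\<in>encodings k (Suc m). h f) =
    (\<Sum>f\<in>encodings k m. \<Sum>u\<in>{1..m}. \<Sum>s<k. h (f(Suc m := (u, s))))"
proof -
  let ?T = "\<lambda>v. {1..<v} \<times> {..<k}"
  have notin: "Suc m \<notin> {2..m}" by simp
  have ins: "{2..Suc m} = insert (Suc m) {2..m}" using m by auto
  have eq: "encodings k (Suc m) = (\<lambda>(y, g). g(Suc m := y)) ` (?T (Suc m) \<times> encodings k m)"
    unfolding encodings_def ins by (rule PiE_insert_eq)
  have inj: "inj_on (\<lambda>(y, g). g(Suc m := y)) (?T (Suc m) \<times> encodings k m)"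
    unfolding encodings_def by (rule inj_combinator[OF notin])
  have "(\<Sum>f\<in>encodings k (Suc m). h f) = (\<Sum>(y, f)\<in>?T (Suc m) \<times> encodings k m. h (f(Suc m := y)))"
    unfolding eq by (subst sum.reindex[OF inj]) (simp add: case_prod_unfold)
  also have "\<dots> = (\<Sum>f\<in>encodings k m. \<Sum>y\<in>?T (Suc m). h (f(Suc m := y)))"
    by (subst sum.cartesian_product[symmetric], rule sum.swap)
  also have "\<dots> = (\<Sum>f\<in>encodings k m. \<Sum>u\<in>{1..m}. \<Sum>s<k. h (f(Suc m := (u, s))))"
    by (simp add: sum.cartesian_product case_prod_unfold atLeastLessThanSuc_atLeastAtMost)
  finally show ?thesis .
qed

section \<open>Effect of inserting the largest label on old and young leaves\<close>

context
  fixes k m :: nat and f :: "nat \<Rightarrow> nat \<times> nat"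
  assumes m: "m \<ge> 2" and f: "f \<in> encodings k m"
begin

private lemma ins: "{2..Suc m} = insert (Suc m) {2..m}" using m by auto

private lemma root_inner: "1 \<in> inner m f"
proof -
  have "fst (f 2) = 1" using encodings_apply[OF f, of 2] m by auto
  then show ?thesis using m by (force simp: inner_def)
qed

private lemma inner_upd: "inner (Suc m) (f(Suc m := (u, s))) = insert u (inner m f)"
  unfolding inner_def ins by (auto simp: image_iff)

text \<open>For \<open>m \<ge> 2\<close> the root is internal, since the label \<open>2\<close> can
  only hang below \<open>1\<close>. Hence every leaf is a non-root node, and it is either old or
  young.\<close>

lemma leaf_labels_partition:
  "{1..m} = old_leaf_labels m f \<union> (young_leaf_labels m f \<union> inner m f)"
  "old_leaf_labels m f \<inter> young_leaf_labels m f = {}"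
  "old_leaf_labels m f \<inter> inner m f = {}" "young_leaf_labels m f \<inter> inner m f = {}"
proof -
  have "v \<in> {2..m}" if "v \<in> {1..m}" "v \<notin> inner m f" for v
    using that root_inner by (cases "v = 1") auto
  then show "{1..m} = old_leaf_labels m f \<union> (young_leaf_labels m f \<union> inner m f)"
    using inner_subset[OF f] unfolding old_leaf_labels_def young_leaf_labels_def
    by (auto simp: not_le)
qed (auto simp: old_leaf_labels_def young_leaf_labels_def)

text \<open>Two old leaves with a common grand parent would each be the greatest of its grand
  children.\<close>

lemma inj_parent_old: "inj_on (\<lambda>v. fst (f v)) (old_leaf_labels m f)"
  by (rule inj_onI) (force simp: old_leaf_labels_def intro: antisym)

lemma parent_old_subset: "(\<lambda>v. fst (f v)) ` old_leaf_labels m f \<subseteq> inner m f"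
  by (auto simp: old_leaf_labels_def inner_def)

text \<open>As \<open>u\<close> had no grand children, \<open>Suc m\<close> has no competitor and is
  an old leaf. The only other change is that \<open>u\<close> stops being a leaf.\<close>

lemma old_insert_at_leaf:
  assumes "u \<in> {2..m}" "u \<notin> inner m f"
  shows "old_leaf_labels (Suc m) (f(Suc m := (u, s))) = insert (Suc m) (old_leaf_labels m f - {u})"
    "young_leaf_labels (Suc m) (f(Suc m := (u, s))) = young_leaf_labels m f - {u}"
proof -
  have a: "fst (f v) \<noteq> u" if "v \<in> {2..m}" for v using assms(2) that by (auto simp: inner_def)
  have b: "Suc m \<notin> inner m f" using inner_subset[OF f] by auto
  show "old_leaf_labels (Suc m) (f(Suc m := (u, s))) = insert (Suc m) (old_leaf_labels m f - {u})"
    unfolding old_leaf_labels_def inner_upd ins using a b assms(1) by auto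
  show "young_leaf_labels (Suc m) (f(Suc m := (u, s))) = young_leaf_labels m f - {u}"
    unfolding young_leaf_labels_def inner_upd ins using a b assms(1) by auto
qed

text \<open>\<open>Suc m\<close> takes over as greatest grand child of \<open>u\<close>. If the
  previous greatest one was a leaf, it turns from old to young; nothing else changes.\<close>

lemma old_insert_at_inner:
  assumes "u \<in> inner m f"
  shows "old_leaf_labels (Suc m) (f(Suc m := (u, s))) =
      insert (Suc m) {v \<in> old_leaf_labels m f. fst (f v) \<noteq> u}"
    "young_leaf_labels (Suc m) (f(Suc m := (u, s))) =
      young_leaf_labels m f \<union> {v \<in> old_leaf_labels m f. fst (f v) = u}"
proof -
  have b: "Suc m \<notin> inner m f" "u \<noteq> Suc m" using inner_subset[OF f] assms by auto
  have c: "insert u (inner m f) = inner m f" using assms by auto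
  show "old_leaf_labels (Suc m) (f(Suc m := (u, s))) =
      insert (Suc m) {v \<in> old_leaf_labels m f. fst (f v) \<noteq> u}"
    unfolding old_leaf_labels_def inner_upd ins c using b by auto
  show "young_leaf_labels (Suc m) (f(Suc m := (u, s))) =
      young_leaf_labels m f \<union> {v \<in> old_leaf_labels m f. fst (f v) = u}"
    unfolding young_leaf_labels_def old_leaf_labels_def inner_upd ins c using b
    by (auto simp: not_le)
qed

text \<open>Distinct old leaves have distinct grand parents, so there are at least as many internal
  nodes as old leaves, while old leaves, young leaves and internal nodes together number
  \<open>m\<close>.\<close>

lemma card_labels_le: "2 * card (old_leaf_labels m f) + card (young_leaf_labels m f) \<le> m"
  and card_rest_inner: "card (inner m f - (\<lambda>v. fst (f v)) ` old_leaf_labels m f) =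
    m - 2 * card (old_leaf_labels m f) - card (young_leaf_labels m f)"
proof -
  note p = leaf_labels_partition
  have fin: "finite (inner m f)" by (simp add: inner_def)
  have "card {1..m} = card (old_leaf_labels m f) + card (young_leaf_labels m f \<union> inner m f)"
    unfolding p(1) by (rule card_Un_disjoint) (use p fin in auto)
  also have "card (young_leaf_labels m f \<union> inner m f) = card (young_leaf_labels m f) + card (inner m f)"
    by (rule card_Un_disjoint) (use p fin in auto)
  finally have 1: "m = card (old_leaf_labels m f) + (card (young_leaf_labels m f) + card (inner m f))"
    by simp
  have 2: "card ((\<lambda>v. fst (f v)) ` old_leaf_labels m f) = card (old_leaf_labels m f)"
    by (rule card_image[OF inj_parent_old])
  have 3: "card (old_leaf_labels m f) \<le> card (inner m f)"
    using card_mono[OF fin parent_old_subset] 2 by simp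
  show "2 * card (old_leaf_labels m f) + card (young_leaf_labels m f) \<le> m" using 1 3 by simp
  show "card (inner m f - (\<lambda>v. fst (f v)) ` old_leaf_labels m f) =
    m - 2 * card (old_leaf_labels m f) - card (young_leaf_labels m f)"
    using 1 2 by (subst card_Diff_subset[OF _ parent_old_subset]) auto
qed

text \<open>The four terms come from inserting below an old leaf, a young leaf, the grand parent of
  an old leaf, and any other internal node. For \<open>j = 0\<close> the value at
  \<open>j - 1\<close> is cancelled by its factor.\<close>

lemma sum_insert_label:
  fixes g :: "nat \<Rightarrow> nat \<Rightarrow> 'a::comm_semiring_1"
  defines "i \<equiv> card (old_leaf_labels m f)" and "j \<equiv> card (young_leaf_labels m f)"
  shows "(\<Sum>u\<in>{1..m}. g (card (old_leaf_labels (Suc m) (f(Suc m := (u, s)))))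
      (card (young_leaf_labels (Suc m) (f(Suc m := (u, s)))))) =
    of_nat i * g i j + of_nat j * g (Suc i) (j - 1) + of_nat i * g i (Suc j) +
    of_nat (m - 2 * i - j) * g (Suc i) j"
proof -
  let ?O = "old_leaf_labels m f" and ?Y = "young_leaf_labels m f"
  \<comment> \<open>These are the internal labels whose greatest grand child is a leaf.\<close>
  let ?P = "(\<lambda>v. fst (f v)) ` ?O"
  let ?h = "\<lambda>u. g (card (old_leaf_labels (Suc m) (f(Suc m := (u, s)))))
      (card (young_leaf_labels (Suc m) (f(Suc m := (u, s)))))"
  note p = leaf_labels_partition
  have fin: "finite (inner m f)" by (simp add: inner_def)
  have sub: "?O \<subseteq> {2..m}" "?Y \<subseteq> {2..m}" by (auto simp: old_leaf_labels_def young_leaf_labels_def)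
  then have new: "Suc m \<notin> ?O" by auto
  have hO: "?h u = g i j" if "u \<in> ?O" for u
  proof -
    have u: "u \<in> {2..m}" "u \<notin> inner m f" using that by (auto simp: old_leaf_labels_def)
    have "card (insert (Suc m) (?O - {u})) = i"
      using card_Suc_Diff1[of ?O u] that new by (simp add: i_def del: card_Diff_singleton)
    moreover have "?Y - {u} = ?Y" using that p by auto
    ultimately show ?thesis by (simp add: old_insert_at_leaf[OF u] j_def)
  qed
  have hY: "?h u = g (Suc i) (j - 1)" if "u \<in> ?Y" for u
  proof -
    have u: "u \<in> {2..m}" "u \<notin> inner m f" using that by (auto simp: young_leaf_labels_def)
    have "?O - {u} = ?O" using that p by auto
    then show ?thesis using that new by (simp add: old_insert_at_leaf[OF u] i_def j_def)
  qed
  have hP: "?h u = g i (Suc j)" if "u \<in> ?P" for u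
  proof -
    from that obtain v where v: "v \<in> ?O" "fst (f v) = u" by auto
    have u: "u \<in> inner m f" using that parent_old_subset by auto
    have 1: "{w \<in> ?O. fst (f w) = u} = {v}" using inj_onD[OF inj_parent_old] v by auto
    then have 2: "{w \<in> ?O. fst (f w) \<noteq> u} = ?O - {v}" by auto
    have "card (insert (Suc m) (?O - {v})) = i"
      using card_Suc_Diff1[of ?O v] v new by (simp add: i_def del: card_Diff_singleton)
    moreover have "v \<notin> ?Y" using v p(2) by auto
    then have "card (?Y \<union> {v}) = Suc j" by (simp add: j_def)
    ultimately show ?thesis unfolding old_insert_at_inner[OF u] 1 2 by simp
  qed
  have hR: "?h u = g (Suc i) j" if "u \<in> inner m f - ?P" for u
  proof -
    have u: "u \<in> inner m f" using that by auto
    have 1: "{w \<in> ?O. fst (f w) = u} = {}" using that by auto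
    then have 2: "{w \<in> ?O. fst (f w) \<noteq> u} = ?O" by auto
    show ?thesis unfolding old_insert_at_inner[OF u] 1 2 using new by (simp add: i_def j_def)
  qed
  have "(\<Sum>u\<in>{1..m}. ?h u) = (\<Sum>u\<in>?O. ?h u) + (\<Sum>u\<in>?Y \<union> inner m f. ?h u)"
    unfolding p(1) by (rule sum.union_disjoint) (use p fin in auto)
  also have "(\<Sum>u\<in>?Y \<union> inner m f. ?h u) = (\<Sum>u\<in>?Y. ?h u) + (\<Sum>u\<in>inner m f. ?h u)"
    by (rule sum.union_disjoint) (use p fin in auto)
  also have "(\<Sum>u\<in>inner m f. ?h u) = (\<Sum>u\<in>inner m f - ?P. ?h u) + (\<Sum>u\<in>?P. ?h u)"
    by (rule sum.subset_diff[OF parent_old_subset fin])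
  also have "(\<Sum>u\<in>?O. ?h u) = of_nat i * g i j" using hO by (simp add: i_def)
  also have "(\<Sum>u\<in>?Y. ?h u) = of_nat j * g (Suc i) (j - 1)" using hY by (simp add: j_def)
  also have "(\<Sum>u\<in>?P. ?h u) = of_nat i * g i (Suc j)"
    using hP card_image[OF inj_parent_old] by (simp add: i_def del: image_iff)
  also have "(\<Sum>u\<in>inner m f - ?P. ?h u) = of_nat (m - 2 * i - j) * g (Suc i) j"
    using hR card_rest_inner by (simp add: i_def j_def)
  finally show ?thesis by (simp only: ac_simps)
qed

end

text \<open>The factor \<open>k\<close> counts the positions below the chosen grand parent; the
  position has no influence on which leaves are old or young.\<close>

lemma sum_leaf_labels_Suc:
  fixes g :: "nat \<Rightarrow> nat \<Rightarrow> 'a::comm_semiring_1"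
  assumes "m \<ge> 2"
  shows "(\<Sum>f\<in>encodings k (Suc m). g (card (old_leaf_labels (Suc m) f)) (card (young_leaf_labels (Suc m) f))) =
    (\<Sum>f\<in>encodings k m. (\<lambda>i j. of_nat k * (of_nat i * g i j + of_nat j * g (Suc i) (j - 1) +
      of_nat i * g i (Suc j) + of_nat (m - 2 * i - j) * g (Suc i) j))
      (card (old_leaf_labels m f)) (card (young_leaf_labels m f)))"
proof -
  have m: "m \<ge> 1" using assms by simp
  show ?thesis unfolding sum_encodings_Suc[OF m]
  proof (rule sum.cong[OF refl])
    fix f assume f: "f \<in> encodings k m"
    show "(\<Sum>u\<in>{1..m}. \<Sum>s<k. g (card (old_leaf_labels (Suc m) (f(Suc m := (u, s)))))
        (card (young_leaf_labels (Suc m) (f(Suc m := (u, s)))))) =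
      (\<lambda>i j. of_nat k * (of_nat i * g i j + of_nat j * g (Suc i) (j - 1) +
      of_nat i * g i (Suc j) + of_nat (m - 2 * i - j) * g (Suc i) j))
      (card (old_leaf_labels m f)) (card (young_leaf_labels m f))"
      by (subst sum.swap, subst sum_insert_label[OF assms f]) simp
  qed
qed

lemma sum_leaf_labels_two:
  fixes g :: "nat \<Rightarrow> nat \<Rightarrow> 'a::comm_semiring_1"
  shows "(\<Sum>f\<in>encodings k 2. g (card (old_leaf_labels 2 f)) (card (young_leaf_labels 2 f))) = of_nat k * g 1 0"
proof -
  have "old_leaf_labels 2 f = {2}" "young_leaf_labels 2 f = {}" if "f \<in> encodings k 2" for f
  proof -
    have "fst (f 2) = 1" using encodings_apply(1,2)[OF that, of 2] by simp
    then have "2 \<notin> inner 2 f" by (simp add: inner_def)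
    then show "old_leaf_labels 2 f = {2}" "young_leaf_labels 2 f = {}"
      unfolding old_leaf_labels_def young_leaf_labels_def atLeastAtMost_singleton by blast+
  qed
  moreover have "card (encodings k 2) = k" by (simp add: encodings_def card_PiE)
  ultimately show ?thesis by simp
qed

section \<open>Solving the leaf recursion with binomial coefficients\<close>

text \<open>
  Obtained by substituting the distribution \<open>\<Sum>i. c i * u^i * (1 + v)^(n - 2 * i)\<close> of old (\<open>u\<close>) and
  young (\<open>v\<close>) leaves into the recursion of \<open>sum_leaf_labels_Suc\<close>.
\<close>

fun gamma_rec :: "nat \<Rightarrow> nat \<Rightarrow> nat \<Rightarrow> nat" where
  "gamma_rec k 0 i = 0"
| "gamma_rec k (Suc 0) i = 0"
| "gamma_rec k (Suc (Suc 0)) i = (if i = 1 then k else 0)"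
| "gamma_rec k (Suc (Suc (Suc m))) i = k * (i * gamma_rec k (Suc (Suc m)) i +
    (case i of 0 \<Rightarrow> 0 | Suc i' \<Rightarrow> 2 * (Suc (Suc m) - 2 * i') * gamma_rec k (Suc (Suc m)) i'))"

lemma gamma_rec_Suc:
  "m \<ge> 2 \<Longrightarrow> gamma_rec k (Suc m) i = k * (i * gamma_rec k m i +
    (case i of 0 \<Rightarrow> 0 | Suc i' \<Rightarrow> 2 * (m - 2 * i') * gamma_rec k m i'))"
  by (cases m; cases "m - 1") auto

text \<open>When \<open>i\<close> first passes half of \<open>Suc m\<close>, the contribution of
  \<open>i - 1\<close> carries the factor \<open>m - 2 * (i - 1)\<close>, which is zero.\<close>

lemma gamma_rec_eq_0: "i = 0 \<or> n < 2 * i \<Longrightarrow> gamma_rec k n i = 0"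
  by (induction k n i rule: gamma_rec.induct) (auto split: nat.splits)

text \<open>The linear functional that replaces \<open>v ^ j\<close> by \<open>h j\<close> in the
  expansion of \<open>(1 + v) ^ a\<close>. It lets identities between such powers be used for an
  arbitrary function \<open>h\<close>.\<close>

definition binomial_sum :: "nat \<Rightarrow> (nat \<Rightarrow> 'a::comm_semiring_1) \<Rightarrow> 'a" where
  "binomial_sum a h = (\<Sum>j\<le>a. of_nat (a choose j) * h j)"

text \<open>Pascal's rule, corresponding to
  \<open>(1 + v) ^ Suc a = (1 + v) ^ a + v * (1 + v) ^ a\<close>.\<close>

lemma binomial_sum_Suc: "binomial_sum (Suc a) h = binomial_sum a h + binomial_sum a (\<lambda>j. h (Suc j))"
proof -
  have "binomial_sum (Suc a) h = h 0 + (\<Sum>j\<le>a. of_nat (a choose j) * h (Suc j)) +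
      (\<Sum>j\<le>a. of_nat (a choose Suc j) * h (Suc j))"
    unfolding binomial_sum_def by (subst sum.atMost_Suc_shift) (simp add: algebra_simps sum.distrib)
  moreover have "binomial_sum a h = (\<Sum>j\<le>Suc a. of_nat (a choose j) * h j)"
    by (simp add: binomial_sum_def binomial_eq_0)
  then have "binomial_sum a h = h 0 + (\<Sum>j\<le>a. of_nat (a choose Suc j) * h (Suc j))"
    by (subst (asm) sum.atMost_Suc_shift) simp
  ultimately show ?thesis by (simp add: binomial_sum_def ac_simps)
qed

text \<open>Corresponds to differentiating \<open>(1 + v) ^ a\<close>; termwise it is the absorption
  identity for binomial coefficients.\<close>

lemma binomial_sum_shift_down:
  "binomial_sum a (\<lambda>j. of_nat j * h (j - 1)) = of_nat a * binomial_sum (a - 1) h"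
proof (cases a)
  case (Suc b)
  have "of_nat (Suc b choose Suc j) * (of_nat (Suc j) * h j) = of_nat (Suc b) * (of_nat (b choose j) * h j)" for j
    unfolding mult.assoc[symmetric] of_nat_mult[symmetric] Suc_times_binomial_eq by (rule refl)
  then show ?thesis unfolding Suc binomial_sum_def
    by (subst sum.atMost_Suc_shift) (simp add: sum_distrib_left del: binomial_Suc_Suc of_nat_Suc)
qed (simp add: binomial_sum_def)

text \<open>Termwise the complementary absorption identity: \<open>a - j\<close> times
  \<open>a choose j\<close> is \<open>a\<close> times \<open>a - 1\<close> over
  \<open>j\<close>.\<close>

lemma binomial_sum_weight_compl:
  "binomial_sum a (\<lambda>j. of_nat (a - j) * h j) = of_nat a * binomial_sum (a - 1) h"
proof (cases a)
  case (Suc b)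
  have "of_nat (Suc b choose j) * (of_nat (Suc b - j) * h j) = of_nat (Suc b) * (of_nat (b choose j) * h j)"
    if "j \<le> b" for j
  proof -
    have "(Suc b choose j) * (Suc b - j) = Suc b * (b choose j)"
      using binomial_absorb_comp[of "Suc b" j] by (simp add: mult.commute)
    then show ?thesis unfolding mult.assoc[symmetric] of_nat_mult[symmetric] by (rule arg_cong)
  qed
  then show ?thesis unfolding Suc binomial_sum_def
    by (simp add: sum_distrib_left del: of_nat_Suc)
qed (simp add: binomial_sum_def)

text \<open>Induction with \<open>g\<close> arbitrary, because one insertion replaces
  \<open>g\<close> by the combination \<open>?G\<close>. Collecting terms with the three rules for
  \<open>binomial_sum\<close> reproduces the recursion of \<open>gamma_rec\<close>.\<close>

lemma sum_leaf_labels: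
  fixes g :: "nat \<Rightarrow> nat \<Rightarrow> 'a::comm_semiring_1"
  assumes "n \<ge> 2"
  shows "(\<Sum>f\<in>encodings k n. g (card (old_leaf_labels n f)) (card (young_leaf_labels n f))) =
    (\<Sum>i\<le>n. of_nat (gamma_rec k n i) * binomial_sum (n - 2 * i) (g i))"
  using assms
proof (induction n arbitrary: g rule: nat_induct_at_least)
  case base
  show ?case unfolding sum_leaf_labels_two
    by (simp add: numeral_2_eq_2 binomial_sum_def)
next
  case (Suc m)
  let ?c = "\<lambda>i. of_nat (gamma_rec k m i) :: 'a"
  let ?G = "\<lambda>i j. of_nat k * (of_nat i * g i j + of_nat j * g (Suc i) (j - 1) +
      of_nat i * g i (Suc j) + of_nat (m - 2 * i - j) * g (Suc i) j)"
  \<comment> \<open>With \<open>a = m - 2 * i\<close>, the two terms that keep \<open>i\<close>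
    combine by Pascal's rule to exponent \<open>Suc a\<close>, and the two that raise
    \<open>i\<close> each give \<open>a\<close> times the sum of exponent \<open>a - 1\<close>;
    hence the factor 2.\<close>
  have step: "?c i * binomial_sum (m - 2 * i) (?G i) =
      of_nat (k * i * gamma_rec k m i) * binomial_sum (Suc m - 2 * i) (g i) +
      of_nat (k * (2 * (m - 2 * i) * gamma_rec k m i)) * binomial_sum (Suc m - 2 * Suc i) (g (Suc i))" for i
  proof (cases "2 * i \<le> m")
    case True
    define a where "a = m - 2 * i"
    have a: "Suc m - 2 * i = Suc a" "Suc m - 2 * Suc i = a - 1" using True by (auto simp: a_def)
    have "binomial_sum a (?G i) = of_nat k * (of_nat i * (binomial_sum a (g i) + binomial_sum a (\<lambda>j. g i (Suc j))) +
      (binomial_sum a (\<lambda>j. of_nat j * g (Suc i) (j - 1)) + binomial_sum a (\<lambda>j. of_nat (a - j) * g (Suc i) j)))"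
      by (simp add: binomial_sum_def sum_distrib_left sum.distrib algebra_simps a_def)
    also have "\<dots> = of_nat k * (of_nat i * binomial_sum (Suc a) (g i) +
        2 * of_nat a * binomial_sum (a - 1) (g (Suc i)))"
      unfolding binomial_sum_Suc binomial_sum_shift_down binomial_sum_weight_compl
      by (simp add: algebra_simps mult_2)
    finally show ?thesis unfolding a a_def[symmetric] by (simp add: algebra_simps)
  next
    case False
    then show ?thesis by (simp add: gamma_rec_eq_0)
  qed
  have "(\<Sum>f\<in>encodings k (Suc m). g (card (old_leaf_labels (Suc m) f)) (card (young_leaf_labels (Suc m) f))) =
      (\<Sum>i\<le>m. ?c i * binomial_sum (m - 2 * i) (?G i))"
    unfolding sum_leaf_labels_Suc[OF \<open>2 \<le> m\<close>] by (rule Suc.IH)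
  also have "\<dots> = (\<Sum>i\<le>m. of_nat (k * i * gamma_rec k m i) * binomial_sum (Suc m - 2 * i) (g i)) +
      (\<Sum>i\<le>m. of_nat (k * (2 * (m - 2 * i) * gamma_rec k m i)) * binomial_sum (Suc m - 2 * Suc i) (g (Suc i)))"
    unfolding step by (rule sum.distrib)
  also have "(\<Sum>i\<le>m. of_nat (k * i * gamma_rec k m i) * binomial_sum (Suc m - 2 * i) (g i)) =
      (\<Sum>i\<le>Suc m. of_nat (k * i * gamma_rec k m i) * binomial_sum (Suc m - 2 * i) (g i))"
    by (simp add: gamma_rec_eq_0)
  also have "(\<Sum>i\<le>m. of_nat (k * (2 * (m - 2 * i) * gamma_rec k m i)) * binomial_sum (Suc m - 2 * Suc i) (g (Suc i))) =
      (\<Sum>i\<le>Suc m. of_nat (k * (case i of 0 \<Rightarrow> 0 | Suc i' \<Rightarrow> 2 * (m - 2 * i') * gamma_rec k m i')) *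
        binomial_sum (Suc m - 2 * i) (g i))"
    by (subst sum.atMost_Suc_shift) simp
  finally show ?case
    unfolding gamma_rec_Suc[OF \<open>2 \<le> m\<close>] sum.distrib[symmetric]
    by (simp add: algebra_simps)
qed

text \<open>With \<open>l = i + j\<close> leaves, inserting below an old or a young leaf keeps
  \<open>l\<close>, and the other \<open>i + (m - 2 * i - j) = m - l\<close> choices raise it by
  one. This is the recursion of the plateaus.\<close>

lemma sum_leaf_labels_eq_Qtilde:
  fixes g :: "nat \<Rightarrow> 'a::comm_semiring_1"
  assumes "n \<ge> 2" and k: "k \<ge> 1"
  shows "(\<Sum>w\<in>Qtilde k n. g (ap k w)) =
    (\<Sum>f\<in>encodings k n. g (card (old_leaf_labels n f) + card (young_leaf_labels n f)))"
  using assms(1)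
proof (induction n arbitrary: g rule: nat_induct_at_least)
  case base
  show ?case using sum_leaf_labels_two[of "\<lambda>i j. g (i + j)"] sum_Qtilde_two[OF k, of g] by simp
next
  case (Suc m)
  have m: "m \<ge> 1" using Suc by simp
  have "(\<Sum>w\<in>Qtilde k (Suc m). g (ap k w)) =
      (\<Sum>f\<in>encodings k m. (\<lambda>l. of_nat (k * l) * g l + of_nat (k * (m - l)) * g (Suc l))
        (card (old_leaf_labels m f) + card (young_leaf_labels m f)))"
    unfolding sum_Qtilde_Suc[OF m k] by (rule Suc.IH)
  also have "\<dots> = (\<Sum>f\<in>encodings k (Suc m).
      g (card (old_leaf_labels (Suc m) f) + card (young_leaf_labels (Suc m) f)))"
    unfolding sum_leaf_labels_Suc[OF \<open>2 \<le> m\<close>, where g = "\<lambda>i j. g (i + j)"]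
  proof (rule sum.cong[OF refl])
    fix f assume f: "f \<in> encodings k m"
    define i j where "i = card (old_leaf_labels m f)" and "j = card (young_leaf_labels m f)"
    have "2 * i + j \<le> m" using card_labels_le[OF \<open>2 \<le> m\<close> f] by (simp add: i_def j_def)
    then obtain r where r: "m = 2 * i + j + r" using le_Suc_ex by blast
    \<comment> \<open>For \<open>j = 0\<close> the arguments of \<open>g\<close> differ, but both
      sides have the factor zero.\<close>
    have "of_nat j * g (Suc i + (j - 1)) = of_nat j * g (i + j)" by (cases j) auto
    moreover have "m - (i + j) = i + r" "m - 2 * i - j = r" using r by auto
    ultimately show "(\<lambda>l. of_nat (k * l) * g l + of_nat (k * (m - l)) * g (Suc l))
        (card (old_leaf_labels m f) + card (young_leaf_labels m f)) =
      (\<lambda>i j. of_nat k * (of_nat i * g (i + j) + of_nat j * g (Suc i + (j - 1)) +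
      of_nat i * g (i + Suc j) + of_nat (m - 2 * i - j) * g (Suc i + j)))
      (card (old_leaf_labels m f)) (card (young_leaf_labels m f))"
      unfolding i_def[symmetric] j_def[symmetric] by (simp only:) (simp add: algebra_simps)
  qed
  finally show ?case .
qed

section \<open>Increasing pruned even trees\<close>

lemma Nil_in_nodes [simp]: "[] \<in> nodes t"
  by (simp add: nodes_def)

lemma Cons_in_nodes [simp]:
  "i # p \<in> nodes t \<longleftrightarrow> i < length (children t) \<and> p \<in> nodes (children t ! i)"
  by (simp add: nodes_def)

lemma subtree_append [simp]: "subtree t (p @ q) = subtree (subtree t p) q"
  by (induction p arbitrary: t) auto

lemma append_in_nodes [simp]: "p @ q \<in> nodes t \<longleftrightarrow> p \<in> nodes t \<and> q \<in> nodes (subtree t p)"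
  by (induction p arbitrary: t) auto

text \<open>Makes conditions on addresses accessible to structural induction; \<open>l\<close> is
  the level of the root of \<open>t\<close> in a surrounding tree.\<close>

lemma ball_nodes_iff:
  "(\<forall>p\<in>nodes t. P (l + length p) (subtree t p)) \<longleftrightarrow>
    P l t \<and> (\<forall>c\<in>set (children t). \<forall>p\<in>nodes c. P (Suc l + length p) (subtree c p))"
  (is "?L \<longleftrightarrow> ?R")
proof
  assume L: ?L
  have "P (Suc l + length p) (subtree c p)" if c: "c \<in> set (children t)" and p: "p \<in> nodes c" for c p
  proof -
    obtain i where "i < length (children t)" "c = children t ! i" using c by (auto simp: in_set_conv_nth)
    then show ?thesis using bspec[OF L, of "i # p"] p by simp
  qed
  then show ?R using bspec[OF L, of "[]"] by simp
next
  assume R: ?R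
  show ?L
  proof
    fix p assume "p \<in> nodes t"
    then show "P (l + length p) (subtree t p)" using R by (cases p) auto
  qed
qed

text \<open>The local condition that characterises even-level nodes of pruned trees: either all
  children were deleted, or all \<open>k\<close> remain because one of them is not a leaf.\<close>

definition leaf_or_full :: "nat \<Rightarrow> 'a otree \<Rightarrow> bool" where
  "leaf_or_full k t \<longleftrightarrow>
     children t = [] \<or> length (children t) = k \<and> (\<exists>c\<in>set (children t). children c \<noteq> [])"

lemma children_prune_at_odd: "odd l \<Longrightarrow> children (prune_at l t) = map (prune_at (Suc l)) (children t)"
  by (cases t) simp

text \<open>Pruning never removes children of an odd-level node, so the child that prevents an
  even-level node from being pruned still has children afterwards.\<close>

lemma leaf_or_full_prune_at:
  assumes "\<forall>p\<in>nodes t. even (l + length p) \<longrightarrow> length (children (subtree t p)) = k"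
  shows "\<forall>p\<in>nodes (prune_at l t). even (l + length p) \<longrightarrow> leaf_or_full k (subtree (prune_at l t) p)"
  using assms
proof (induction t arbitrary: l)
  case (Node a ts)
  note all = ball_nodes_iff[where P = "\<lambda>l t. even l \<longrightarrow> length (children t) = k"]
  note all' = ball_nodes_iff[where P = "\<lambda>l t. even l \<longrightarrow> leaf_or_full k t"]
  from Node.prems have len: "even l \<longrightarrow> length ts = k"
    and sub: "\<And>t. t \<in> set ts \<Longrightarrow> \<forall>p\<in>nodes t. even (Suc l + length p) \<longrightarrow> length (children (subtree t p)) = k"
    unfolding all[of "Node a ts"] by auto
  have IH: "\<forall>p\<in>nodes (prune_at (Suc l) t). even (Suc l + length p) \<longrightarrow>
      leaf_or_full k (subtree (prune_at (Suc l) t) p)" if "t \<in> set ts" for t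
    by (rule Node.IH[OF that sub[OF that]])
  show ?case unfolding all'[of "prune_at l (Node a ts)"]
  proof
    show "even l \<longrightarrow> leaf_or_full k (prune_at l (Node a ts))"
      using len by (auto simp: leaf_or_full_def children_prune_at_odd)
    show "\<forall>c\<in>set (children (prune_at l (Node a ts))). \<forall>p\<in>nodes c. even (Suc l + length p) \<longrightarrow>
        leaf_or_full k (subtree c p)"
      using IH by auto
  qed
qed

text \<open>Undoes pruning by giving every even-level leaf \<open>k\<close> leaves as
  children.\<close>

fun fill :: "nat \<Rightarrow> nat \<Rightarrow> unit otree \<Rightarrow> unit otree" where
  "fill k l (Node a ts) =
     Node a (if even l \<and> ts = [] then replicate k (Node () []) else map (fill k (Suc l)) ts)"

lemma children_fill_odd: "odd l \<Longrightarrow> children (fill k l t) = map (fill k (Suc l)) (children t)"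
  by (cases t) simp

lemma fill_even_kary_prune:
  assumes "\<forall>p\<in>nodes s. even (l + length p) \<longrightarrow> leaf_or_full k (subtree s p)"
  shows "prune_at l (fill k l s) = s \<and>
    (\<forall>p\<in>nodes (fill k l s). even (l + length p) \<longrightarrow> length (children (subtree (fill k l s) p)) = k)"
  using assms
proof (induction s arbitrary: l)
  case (Node a ts)
  note all = ball_nodes_iff[where P = "\<lambda>l t. even l \<longrightarrow> length (children t) = k"]
  note all' = ball_nodes_iff[where P = "\<lambda>l t. even l \<longrightarrow> leaf_or_full k t"]
  from Node.prems have top: "even l \<Longrightarrow> leaf_or_full k (Node a ts)"
    and sub: "\<And>t. t \<in> set ts \<Longrightarrow> \<forall>p\<in>nodes t. even (Suc l + length p) \<longrightarrow> leaf_or_full k (subtree t p)"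
    unfolding all'[of "Node a ts"] by auto
  have IH: "prune_at (Suc l) (fill k (Suc l) t) = t"
    "\<forall>p\<in>nodes (fill k (Suc l) t). even (Suc l + length p) \<longrightarrow>
      length (children (subtree (fill k (Suc l) t) p)) = k" if "t \<in> set ts" for t
    using Node.IH[OF that sub[OF that]] by auto
  show ?case
  proof (cases "even l \<and> ts = []")
    case True
    then have "fill k l (Node a ts) = Node a (replicate k (Node () []))" by simp
    moreover have "nodes (Node () []) = {[]}"
    proof -
      have "p = []" if "p \<in> nodes (Node () [])" for p using that by (cases p) auto
      then show ?thesis by auto
    qed
    ultimately show ?thesis unfolding all[of "fill k l (Node a ts)"] using True by auto
  next
    case False
    have f: "fill k l (Node a ts) = Node a (map (fill k (Suc l)) ts)" using False by (simp only: fill.simps if_False)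
    \<comment> \<open>The child with children lies at an odd level, where filling preserves the
      number of children; so this node is not pruned.\<close>
    have "\<not> (\<forall>t\<in>set (map (fill k (Suc l)) ts). children t = [])" if "even l"
      using top[OF that] False that by (auto simp: leaf_or_full_def children_fill_odd)
    then have "prune_at l (Node a (map (fill k (Suc l)) ts)) =
        Node a (map (prune_at (Suc l)) (map (fill k (Suc l)) ts))" by auto
    also have "\<dots> = Node a ts" using IH(1) by (simp add: map_idI)
    finally have "prune_at l (fill k l (Node a ts)) = Node a ts" unfolding f .
    moreover have "even l \<longrightarrow> length (children (fill k l (Node a ts))) = k"
      unfolding f using top False by (auto simp: leaf_or_full_def)
    ultimately show ?thesis unfolding all[of "fill k l (Node a ts)"] unfolding f using IH(2) by auto
  qed
qed

lemma pruned_even_kary_iff: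
  "pruned_even_kary k s \<longleftrightarrow> (\<forall>p\<in>nodes s. even (level p) \<longrightarrow> leaf_or_full k (subtree s p))"
proof
  assume "pruned_even_kary k s"
  then obtain t where "even_kary k t" "s = prune_at 0 t" by (auto simp: pruned_even_kary_def prune_def)
  then show "\<forall>p\<in>nodes s. even (level p) \<longrightarrow> leaf_or_full k (subtree s p)"
    using leaf_or_full_prune_at[of t 0 k] by (auto simp: even_kary_def)
next
  assume "\<forall>p\<in>nodes s. even (level p) \<longrightarrow> leaf_or_full k (subtree s p)"
  then show "pruned_even_kary k s"
    using fill_even_kary_prune[of s 0 k]
    by (auto simp: pruned_even_kary_def even_kary_def prune_def intro!: exI[of _ "fill k 0 s"])
qed

lemma children_shape [simp]: "children (shape t) = map shape (children t)"
  by (cases t) (simp add: shape_def)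

lemma nodes_shape [simp]: "nodes (shape t) = nodes t"
proof -
  have "p \<in> nodes (shape t) \<longleftrightarrow> p \<in> nodes t" for p by (induction p arbitrary: t) auto
  then show ?thesis by blast
qed

lemma subtree_shape: "p \<in> nodes t \<Longrightarrow> subtree (shape t) p = shape (subtree t p)"
  by (induction p arbitrary: t) auto

lemma leaf_or_full_shape [simp]: "leaf_or_full k (shape t) \<longleftrightarrow> leaf_or_full k t"
  by (simp add: leaf_or_full_def)

lemma pruned_even_kary_shape:
  "pruned_even_kary k (shape t) \<longleftrightarrow> (\<forall>p\<in>nodes t. even (level p) \<longrightarrow> leaf_or_full k (subtree t p))"
  by (auto simp: pruned_even_kary_iff subtree_shape)

section \<open>Labeled nodes and the passage between trees and encodings\<close>

lemma Nil_in_labeled_nodes [simp]: "[] \<in> labeled_nodes T"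
  by (simp add: labeled_nodes_def)

lemma grand_child_in_labeled_nodes:
  "p @ [i, j] \<in> labeled_nodes T \<longleftrightarrow> p \<in> labeled_nodes T \<and>
    i < length (children (subtree T p)) \<and> j < length (children (children (subtree T p) ! i))"
  by (auto simp: labeled_nodes_def)

lemma labeled_nodes_cases:
  assumes "p \<in> labeled_nodes T" "p \<noteq> []"
  obtains q i j where "p = q @ [i, j]" "q \<in> labeled_nodes T"
proof -
  from assms have e: "even (length p)" "p \<noteq> []" by (auto simp: labeled_nodes_def)
  obtain r j where r: "p = r @ [j]" using e(2) by (metis rev_exhaust)
  then have "r \<noteq> []" using e by auto
  then obtain q i where "r = q @ [i]" by (metis rev_exhaust)
  then have p: "p = q @ [i, j]" using r by simp
  then have "q \<in> labeled_nodes T" using assms(1) grand_child_in_labeled_nodes by blast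
  then show thesis using that p by blast
qed

text \<open>A relation, so that the facts derived from it apply both to an encoding read off a given
  tree and to an encoding from which the tree was built.\<close>

definition encodes :: "nat option otree \<Rightarrow> (nat \<Rightarrow> nat \<times> nat) \<Rightarrow> bool" where
  "encodes T f \<longleftrightarrow>
     (\<forall>p i j. p @ [i, j] \<in> labeled_nodes T \<longrightarrow> f (lab T (p @ [i, j])) = (lab T p, i))"

text \<open>Lists, from left to right, the labels below the unlabeled node at position
  \<open>i\<close> under \<open>v\<close>. The bound \<open>v < w\<close> makes
  \<open>decode\<close> terminate; encodings satisfy it on \<open>{2..n}\<close> anyway.\<close>

definition slot :: "nat \<Rightarrow> (nat \<Rightarrow> nat \<times> nat) \<Rightarrow> nat \<Rightarrow> nat \<Rightarrow> nat list" where
  "slot n f v i = sorted_list_of_set {w \<in> {v<..n}. f w = (v, i)}"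

lemma set_slot: "set (slot n f v i) = {w \<in> {v<..n}. f w = (v, i)}"
  by (simp add: slot_def)

lemma sorted_distinct_slot: "sorted (slot n f v i)" "distinct (slot n f v i)"
  by (simp_all add: slot_def)

text \<open>The case distinction reflects pruning: a node without grand children gets no children at
  all, any other node gets all \<open>k\<close>, including the empty ones.\<close>

function decode :: "nat \<Rightarrow> nat \<Rightarrow> (nat \<Rightarrow> nat \<times> nat) \<Rightarrow> nat \<Rightarrow> nat option otree" where
  "decode k n f v = Node (Some v)
     (if \<forall>i<k. slot n f v i = [] then []
      else map (\<lambda>i. Node None (map (decode k n f) (slot n f v i))) [0..<k])"
  by auto
termination
  by (relation "measure (\<lambda>(k, n, f, v). n - v)") (auto simp: set_slot)

declare decode.simps [simp del]

section \<open>Reconstructing an increasing tree from its encoding\<close>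

context
  fixes k n :: nat and T :: "nat option otree"
  assumes T: "T \<in> inc_trees k n"
begin

lemma labeled_leaf_or_full: "p \<in> labeled_nodes T \<Longrightarrow> leaf_or_full k (subtree T p)"
  using T by (auto simp: inc_trees_def pruned_even_kary_shape labeled_nodes_def)

lemma node_label_odd: "p \<in> nodes T \<Longrightarrow> odd (level p) \<Longrightarrow> node_label T p = None"
  using T by (auto simp: inc_trees_def)

lemma bij_node_label: "bij_betw (node_label T) (labeled_nodes T) (Some ` {1..n})"
  using T by (simp add: inc_trees_def)

lemma lab_less_descendant:
  "p \<in> labeled_nodes T \<Longrightarrow> p @ q \<in> labeled_nodes T \<Longrightarrow> q \<noteq> [] \<Longrightarrow> lab T p < lab T (p @ q)"
  using T unfolding inc_trees_def by blast

lemma lab_less_sibling: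
  "i < j \<Longrightarrow> p @ [i] \<in> labeled_nodes T \<Longrightarrow> p @ [j] \<in> labeled_nodes T \<Longrightarrow>
    lab T (p @ [i]) < lab T (p @ [j])"
  using T unfolding inc_trees_def by blast

lemma node_label_eq_Some:
  assumes "p \<in> labeled_nodes T" shows "node_label T p = Some (lab T p)" "lab T p \<in> {1..n}"
proof -
  have "node_label T p \<in> Some ` {1..n}" using bij_betwE[OF bij_node_label] assms by blast
  then show "node_label T p = Some (lab T p)" "lab T p \<in> {1..n}" by auto
qed

lemma bij_lab: "bij_betw (lab T) (labeled_nodes T) {1..n}"
proof -
  have "bij_betw the (Some ` {1..n}) {1..n}" by (auto simp: bij_betw_def inj_on_def image_image)
  from bij_betw_trans[OF bij_node_label this] show ?thesis by (simp add: comp_def)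
qed

lemma lab_eqD: "p \<in> labeled_nodes T \<Longrightarrow> q \<in> labeled_nodes T \<Longrightarrow> lab T p = lab T q \<Longrightarrow> p = q"
  using bij_lab by (auto simp: bij_betw_def inj_on_def)

text \<open>The label \<open>1\<close> occurs somewhere, and every node below the root has a larger
  label than the root.\<close>

lemma lab_root: "lab T [] = 1"
proof -
  have r: "lab T [] \<in> {1..n}" by (rule node_label_eq_Some) simp
  then have "1 \<in> lab T ` labeled_nodes T" using bij_lab by (auto simp: bij_betw_def)
  then obtain p where p: "p \<in> labeled_nodes T" "lab T p = 1" by auto
  show ?thesis using lab_less_descendant[of "[]" p] p r by (cases "p = []") auto
qed

lemma grand_child_of_label:
  assumes "w \<in> {2..n}"
  obtains q i j where "q @ [i, j] \<in> labeled_nodes T" "q \<in> labeled_nodes T" "lab T (q @ [i, j]) = w"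
proof -
  have "w \<in> lab T ` labeled_nodes T" using bij_lab assms by (auto simp: bij_betw_def)
  then obtain p where p: "p \<in> labeled_nodes T" "lab T p = w" by auto
  have "p \<noteq> []" using p assms lab_root by auto
  then show thesis using labeled_nodes_cases[OF p(1)] p that by metis
qed

lemma grand_child_label_bounds:
  assumes "p @ [i, j] \<in> labeled_nodes T"
  shows "lab T p < lab T (p @ [i, j])" "lab T (p @ [i, j]) \<in> {2..n}"
proof -
  have p: "p \<in> labeled_nodes T" using assms grand_child_in_labeled_nodes by blast
  show "lab T p < lab T (p @ [i, j])" by (rule lab_less_descendant[OF p assms]) simp
  then show "lab T (p @ [i, j]) \<in> {2..n}" using node_label_eq_Some(2)[OF p] node_label_eq_Some(2)[OF assms] by auto
qed

text \<open>Pruning gives the non-trivial direction: an even-level node that has children has a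
  child with children.\<close>

lemma leaf_iff_no_grand_child:
  assumes "p \<in> labeled_nodes T"
  shows "children (subtree T p) = [] \<longleftrightarrow> (\<forall>i j. p @ [i, j] \<notin> labeled_nodes T)"
proof
  assume no: "\<forall>i j. p @ [i, j] \<notin> labeled_nodes T"
  show "children (subtree T p) = []"
  proof (rule ccontr)
    assume "children (subtree T p) \<noteq> []"
    then obtain c where c: "c \<in> set (children (subtree T p))" "children c \<noteq> []"
      using labeled_leaf_or_full[OF assms] by (auto simp: leaf_or_full_def)
    then obtain i where "i < length (children (subtree T p))" "c = children (subtree T p) ! i"
      by (auto simp: in_set_conv_nth)
    then have "p @ [i, 0] \<in> labeled_nodes T" using assms c by (simp add: grand_child_in_labeled_nodes)
    then show False using no by blast
  qed
qed (simp add: grand_child_in_labeled_nodes)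

lemma exists_encoding: "\<exists>f\<in>encodings k n. encodes T f"
proof -
  define addr where "addr w = (THE p. p \<in> labeled_nodes T \<and> lab T p = w)" for w
  \<comment> \<open>The last entry but one of an address is the position of the unlabeled
    parent.\<close>
  define f where "f = (\<lambda>w\<in>{2..n}. (lab T (grand_parent (addr w)), last (butlast (addr w))))"
  have addr: "addr (lab T p) = p" if "p \<in> labeled_nodes T" for p
    unfolding addr_def using that lab_eqD by blast
  have f: "f (lab T (p @ [i, j])) = (lab T p, i)" if "p @ [i, j] \<in> labeled_nodes T" for p i j
    using addr[OF that] grand_child_label_bounds[OF that]
    by (simp add: f_def grand_parent_def butlast_append)
  have "f \<in> encodings k n" unfolding encodings_def
  proof (rule PiE_I)
    fix w assume "w \<in> {2..n}"
    then obtain q i j where q: "q @ [i, j] \<in> labeled_nodes T" "q \<in> labeled_nodes T" "lab T (q @ [i, j]) = w"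
      by (rule grand_child_of_label)
    then have "i < length (children (subtree T q))" by (simp add: grand_child_in_labeled_nodes)
    then have "i < k" using labeled_leaf_or_full[OF q(2)] by (auto simp: leaf_or_full_def)
    then show "f w \<in> {1..<w} \<times> {..<k}"
      using f[OF q(1)] q grand_child_label_bounds[OF q(1)] node_label_eq_Some(2)[OF q(2)] by auto
  qed (auto simp: f_def)
  moreover have "encodes T f" using f by (simp add: encodes_def)
  ultimately show ?thesis by blast
qed

context
  fixes f :: "nat \<Rightarrow> nat \<times> nat"
  assumes f: "encodes T f"
begin

lemma encodesD: "p @ [i, j] \<in> labeled_nodes T \<Longrightarrow> f (lab T (p @ [i, j])) = (lab T p, i)"
  using f by (simp add: encodes_def)

text \<open>The label \<open>w\<close> sits at some grand child; its grand parent carries the label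
  of \<open>p\<close>, hence is \<open>p\<close> by injectivity of the labels.\<close>

lemma label_eq_grand_child_iff:
  assumes p: "p \<in> labeled_nodes T" and w: "w \<in> {2..n}"
  shows "f w = (lab T p, i) \<longleftrightarrow> (\<exists>j. p @ [i, j] \<in> labeled_nodes T \<and> w = lab T (p @ [i, j]))"
proof
  assume fw: "f w = (lab T p, i)"
  obtain q i' j where q: "q @ [i', j] \<in> labeled_nodes T" "q \<in> labeled_nodes T" "lab T (q @ [i', j]) = w"
    using w by (rule grand_child_of_label)
  then have "lab T q = lab T p" "i' = i" using encodesD[OF q(1)] fw by auto
  then show "\<exists>j. p @ [i, j] \<in> labeled_nodes T \<and> w = lab T (p @ [i, j])"
    using lab_eqD[OF q(2) p] q by blast
qed (auto simp: encodesD)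

text \<open>Siblings increase from left to right, so their label list is already the sorted
  enumeration of the set defining \<open>slot\<close>.\<close>

lemma slot_eq:
  assumes p: "p \<in> labeled_nodes T" and i: "i < length (children (subtree T p))"
  shows "slot n f (lab T p) i =
    map (\<lambda>j. lab T (p @ [i, j])) [0..<length (children (children (subtree T p) ! i))]" (is "_ = ?L")
proof -
  have gc: "p @ [i, j] \<in> labeled_nodes T \<longleftrightarrow> j < length (children (children (subtree T p) ! i))" for j
    using p i by (simp add: grand_child_in_labeled_nodes)
  have v: "1 \<le> lab T p" using node_label_eq_Some(2)[OF p] by simp
  have "{w \<in> {lab T p<..n}. f w = (lab T p, i)} = set ?L"
  proof (intro set_eqI iffI)
    fix w assume w: "w \<in> {w \<in> {lab T p<..n}. f w = (lab T p, i)}"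
    then have "w \<in> {2..n}" using v by auto
    then show "w \<in> set ?L" using label_eq_grand_child_iff[OF p] w gc by auto
  next
    fix w assume "w \<in> set ?L"
    then obtain j where j: "p @ [i, j] \<in> labeled_nodes T" "w = lab T (p @ [i, j])" using gc by auto
    then show "w \<in> {w \<in> {lab T p<..n}. f w = (lab T p, i)}"
      using grand_child_label_bounds[OF j(1)] encodesD[OF j(1)] by auto
  qed
  moreover have "sorted_wrt (<) ?L"
    unfolding sorted_wrt_map
  proof (rule sorted_wrt_mono_rel[OF _ sorted_wrt_upt])
    fix a b assume "a \<in> set [0..<length (children (children (subtree T p) ! i))]"
      "b \<in> set [0..<length (children (children (subtree T p) ! i))]" "a < b"
    then show "lab T (p @ [i, a]) < lab T (p @ [i, b])"
      using lab_less_sibling[of a b "p @ [i]"] gc by simp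
  qed
  then have "sorted ?L" "distinct ?L" by (simp_all only: strict_sorted_iff)
  ultimately show ?thesis unfolding slot_def by (simp only: sorted_list_of_set.idem_if_sorted_distinct)
qed

text \<open>Induction on \<open>n - lab T p\<close>, which drops because grand children have larger
  labels. At the root this shows that the encoding determines the tree.\<close>

lemma subtree_eq_decode: "p \<in> labeled_nodes T \<Longrightarrow> subtree T p = decode k n f (lab T p)"
proof (induction "n - lab T p" arbitrary: p rule: less_induct)
  case less
  define cs where "cs = children (subtree T p)"
  have root: "root_label (subtree T p) = Some (lab T p)"
    using node_label_eq_Some(1)[OF less.prems] by (simp add: node_label_def)
  then have t: "subtree T p = Node (Some (lab T p)) cs" by (cases "subtree T p") (simp add: cs_def)
  have gc: "p @ [i, j] \<in> labeled_nodes T \<longleftrightarrow> i < length cs \<and> j < length (children (cs ! i))" for i j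
    using less.prems by (simp add: grand_child_in_labeled_nodes cs_def)
  have sl: "slot n f (lab T p) i = map (\<lambda>j. lab T (p @ [i, j])) [0..<length (children (cs ! i))]"
    if "i < length cs" for i using slot_eq[OF less.prems] that by (simp add: cs_def)
  have child: "cs ! i = Node None (map (decode k n f) (slot n f (lab T p) i))" if i: "i < length cs" for i
  proof -
    have "p @ [i] \<in> nodes T" using i less.prems by (simp add: cs_def labeled_nodes_def)
    moreover have "odd (level (p @ [i]))" using less.prems by (simp add: labeled_nodes_def)
    ultimately have "node_label T (p @ [i]) = None" by (rule node_label_odd)
    then have "root_label (cs ! i) = None" by (simp add: node_label_def cs_def)
    moreover have "children (cs ! i) = map (decode k n f) (slot n f (lab T p) i)"
    proof (rule nth_equalityI)
      show "length (children (cs ! i)) = length (map (decode k n f) (slot n f (lab T p) i))"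
        using sl[OF i] by simp
      fix j assume j: "j < length (children (cs ! i))"
      then have q: "p @ [i, j] \<in> labeled_nodes T" using gc i by simp
      have "n - lab T (p @ [i, j]) < n - lab T p" using grand_child_label_bounds[OF q] by auto
      from less.hyps[OF this q] have "children (cs ! i) ! j = decode k n f (lab T (p @ [i, j]))"
        by (simp add: cs_def)
      then show "children (cs ! i) ! j = map (decode k n f) (slot n f (lab T p) i) ! j"
        using sl[OF i] j by simp
    qed
    ultimately show ?thesis by (cases "cs ! i") simp
  qed
  show ?case
  proof (cases "cs = []")
    case True
    have "slot n f (lab T p) i = []" for i
    proof (rule ccontr)
      assume "slot n f (lab T p) i \<noteq> []"
      then obtain w where "w \<in> set (slot n f (lab T p) i)" by (meson last_in_set)
      then have w: "lab T p < w" "w \<le> n" "f w = (lab T p, i)" by (auto simp: set_slot)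
      then have "w \<in> {2..n}" using node_label_eq_Some(2)[OF less.prems] by auto
      then show False using label_eq_grand_child_iff[OF less.prems] w gc True by auto
    qed
    then show ?thesis unfolding t True by (simp add: decode.simps)
  next
    case False
    then have k: "length cs = k" and "\<exists>c\<in>set cs. children c \<noteq> []"
      using labeled_leaf_or_full[OF less.prems] by (auto simp: leaf_or_full_def cs_def)
    then obtain i where "i < k" "children (cs ! i) \<noteq> []" by (auto simp: in_set_conv_nth)
    then have ne: "\<not> (\<forall>i<k. slot n f (lab T p) i = [])" using sl[of i] k by auto
    have "cs = map (\<lambda>i. Node None (map (decode k n f) (slot n f (lab T p) i))) [0..<k]"
      by (rule nth_equalityI) (use k child in auto)
    then show ?thesis unfolding t decode.simps[of k n f "lab T p"] if_not_P[OF ne] by simp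
  qed
qed

lemma inner_iff:
  assumes p: "p \<in> labeled_nodes T"
  shows "lab T p \<notin> inner n f \<longleftrightarrow> is_leaf T p"
proof -
  have "lab T p \<in> inner n f \<longleftrightarrow> (\<exists>w\<in>{2..n}. \<exists>i. f w = (lab T p, i))"
    unfolding inner_def by (metis (no_types, lifting) fst_conv image_iff prod.collapse)
  also have "\<dots> \<longleftrightarrow> (\<exists>i j. p @ [i, j] \<in> labeled_nodes T)"
    using label_eq_grand_child_iff[OF p] grand_child_label_bounds by blast
  finally show ?thesis using leaf_iff_no_grand_child[OF p] by (simp add: is_leaf_def)
qed

text \<open>The labels that \<open>f\<close> sends to the same grand parent as \<open>p\<close> are
  exactly those of the grand children of that node.\<close>

lemma young_iff:
  assumes p: "p \<in> labeled_nodes T" and ne: "p \<noteq> []"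
  shows "young T p \<longleftrightarrow> (\<exists>w\<in>{2..n}. fst (f w) = fst (f (lab T p)) \<and> lab T p < w)"
proof -
  obtain q i j where q: "p = q @ [i, j]" "q \<in> labeled_nodes T" using p ne by (rule labeled_nodes_cases)
  have "fst (f (lab T p)) = lab T q" using encodesD p q by auto
  moreover have "fst (f w) = lab T q \<longleftrightarrow> (\<exists>i' j'. q @ [i', j'] \<in> labeled_nodes T \<and> w = lab T (q @ [i', j']))"
    if "w \<in> {2..n}" for w
    using label_eq_grand_child_iff[OF q(2) that] by (metis fst_conv prod.collapse)
  moreover have "grand_children T (grand_parent p) = {r. \<exists>i j. r = q @ [i, j] \<and> r \<in> labeled_nodes T}"
    using q by (auto simp: grand_children_def grand_parent_def butlast_append labeled_nodes_def)
  ultimately have gc: "\<And>w. w \<in> {2..n} \<Longrightarrow> fst (f w) = fst (f (lab T p)) \<longleftrightarrow>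
      (\<exists>i j. q @ [i, j] \<in> labeled_nodes T \<and> w = lab T (q @ [i, j]))"
    and "grand_children T (grand_parent p) = {r. \<exists>i j. r = q @ [i, j] \<and> r \<in> labeled_nodes T}"
    by simp_all
  then have "young T p \<longleftrightarrow> (\<exists>i j. q @ [i, j] \<in> labeled_nodes T \<and> lab T p < lab T (q @ [i, j]))"
    using p ne unfolding young_def old_def by (auto simp: not_le)
  also have "\<dots> \<longleftrightarrow> (\<exists>w\<in>{2..n}. fst (f w) = fst (f (lab T p)) \<and> lab T p < w)"
    using gc grand_child_label_bounds(2) by blast
  finally show ?thesis .
qed

lemma lab_image_young_leaves: "lab T ` young_leaves T = young_leaf_labels n f"
proof (intro set_eqI iffI)
  fix v assume "v \<in> lab T ` young_leaves T"
  then obtain p where p: "v = lab T p" "p \<in> labeled_nodes T" "is_leaf T p" "young T p"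
    by (auto simp: young_leaves_def labeled_leaves_def)
  then have ne: "p \<noteq> []" by (simp add: young_def)
  then have "v \<noteq> 1" using lab_eqD[of p "[]"] p lab_root by auto
  then have "v \<in> {2..n}" using node_label_eq_Some(2)[OF p(2)] p(1) by auto
  then show "v \<in> young_leaf_labels n f" using p ne young_iff inner_iff
    by (auto simp: young_leaf_labels_def)
next
  fix v assume v: "v \<in> young_leaf_labels n f"
  then have v2: "v \<in> {2..n}" by (simp add: young_leaf_labels_def)
  then obtain q i j where "q @ [i, j] \<in> labeled_nodes T" "lab T (q @ [i, j]) = v"
    by (rule grand_child_of_label)
  then obtain p where p: "p \<in> labeled_nodes T" "p \<noteq> []" "lab T p = v" by blast
  then have "p \<in> young_leaves T" using v young_iff[OF p(1,2)] inner_iff[OF p(1)]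
    by (auto simp: young_leaves_def labeled_leaves_def young_leaf_labels_def)
  then show "v \<in> lab T ` young_leaves T" using p by blast
qed

lemma lab_image_labeled_leaves: "lab T ` labeled_leaves T = {1..n} - inner n f"
proof -
  have "lab T ` labeled_leaves T = {v \<in> lab T ` labeled_nodes T. v \<notin> inner n f}"
    unfolding labeled_leaves_def using inner_iff by blast
  then show ?thesis using bij_lab by (auto simp: bij_betw_def)
qed

lemma card_young_leaves: "card (young_leaves T) = card (young_leaf_labels n f)"
proof -
  have "inj_on (lab T) (young_leaves T)"
    using bij_lab by (auto simp: bij_betw_def young_leaves_def labeled_leaves_def intro: inj_on_subset)
  from card_image[OF this] show ?thesis unfolding lab_image_young_leaves by simp
qed

text \<open>Leaves carry the labels outside \<open>inner n f\<close>. Since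
  \<open>n \<ge> 2\<close>, the root is not among them, and the rest splits into old and
  young.\<close>

lemma lleaf_eq:
  assumes n: "n \<ge> 2" and fE: "f \<in> encodings k n"
  shows "lleaf T = card (old_leaf_labels n f) + card (young_leaf_labels n f)"
proof -
  note p = leaf_labels_partition[OF n fE]
  have "inj_on (lab T) (labeled_leaves T)"
    using bij_lab by (auto simp: bij_betw_def labeled_leaves_def intro: inj_on_subset)
  from card_image[OF this] have "lleaf T = card ({1..n} - inner n f)"
    unfolding lab_image_labeled_leaves lleaf_def by simp
  also have "{1..n} - inner n f = old_leaf_labels n f \<union> young_leaf_labels n f"
    using p by blast
  finally show ?thesis using p(2) by (simp add: card_Un_disjoint)
qed

end

end

section \<open>Decoded trees are increasing pruned even trees\<close>

lemma children_decode:
  "children (decode k n f v) = (if \<forall>i<k. slot n f v i = [] then []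
     else map (\<lambda>i. Node None (map (decode k n f) (slot n f v i))) [0..<k])"
  by (subst decode.simps) simp

lemma grand_child_in_decode:
  "i < length (children (decode k n f v)) \<and> j < length (children (children (decode k n f v) ! i)) \<longleftrightarrow>
    i < k \<and> j < length (slot n f v i)"
proof (cases "\<forall>i<k. slot n f v i = []")
  case True
  then show ?thesis by (auto simp: children_decode[of k n f v])
next
  case False
  then show ?thesis unfolding children_decode[of k n f v] if_not_P[OF False] by auto
qed

lemma grand_child_of_decode:
  assumes "i < k" "j < length (slot n f v i)"
  shows "children (children (decode k n f v) ! i) ! j = decode k n f (slot n f v i ! j)"
proof -
  have "\<not> (\<forall>i<k. slot n f v i = [])" using assms by auto
  then show ?thesis using assms by (simp only: children_decode[of k n f v] if_False) simp
qed

lemma root_label_child_decode: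
  "i < length (children (decode k n f v)) \<Longrightarrow> root_label (children (decode k n f v) ! i) = None"
  by (auto simp: children_decode[of k n f v] split: if_splits)

text \<open>The induction consumes two address entries at a time, since \<open>decode\<close> calls
  itself two levels further down and with a larger label.\<close>

lemma subtree_decode:
  assumes "p \<in> nodes (decode k n f v)" "even (length p)" "v \<le> n"
  shows "\<exists>w. subtree (decode k n f v) p = decode k n f w \<and> v \<le> w \<and> w \<le> n \<and> (p \<noteq> [] \<longrightarrow> v < w)"
  using assms
proof (induction p arbitrary: v rule: induct_list012)
  case (3 i j p)
  have ij: "i < k" "j < length (slot n f v i)"
    using 3(3) grand_child_in_decode[of i k n f v j] by auto
  define w where "w = slot n f v i ! j"
  have w: "v < w" "w \<le> n" using nth_mem[OF ij(2)] by (auto simp: w_def set_slot)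
  have "\<exists>u. subtree (decode k n f w) p = decode k n f u \<and> w \<le> u \<and> u \<le> n \<and> (p \<noteq> [] \<longrightarrow> w < u)"
    by (rule 3(1)) (use 3(3,4) w grand_child_of_decode[OF ij] in \<open>auto simp: w_def\<close>)
  then show ?case using w grand_child_of_decode[OF ij] by (auto simp: w_def)
qed auto

lemma root_label_decode [simp]: "root_label (decode k n f v) = Some v"
  by (subst decode.simps) simp

context
  fixes k n :: nat and f :: "nat \<Rightarrow> nat \<times> nat"
  assumes n: "n \<ge> 1" and f: "f \<in> encodings k n"
begin

private abbreviation (input) "D \<equiv> decode k n f 1"

private lemma subtree_D:
  assumes "p \<in> labeled_nodes D"
  shows "subtree D p = decode k n f (lab D p)" "node_label D p = Some (lab D p)" "lab D p \<in> {1..n}"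
    "p \<noteq> [] \<Longrightarrow> 1 < lab D p"
proof -
  obtain w where "subtree D p = decode k n f w" "1 \<le> w" "w \<le> n" "p \<noteq> [] \<longrightarrow> 1 < w"
    using subtree_decode[of p k n f 1] assms n by (auto simp: labeled_nodes_def)
  then show "subtree D p = decode k n f (lab D p)" "node_label D p = Some (lab D p)"
    "lab D p \<in> {1..n}" "p \<noteq> [] \<Longrightarrow> 1 < lab D p" by (auto simp: node_label_def)
qed

private lemma grand_child_D:
  assumes p: "p \<in> labeled_nodes D"
  shows "p @ [i, j] \<in> labeled_nodes D \<longleftrightarrow> i < k \<and> j < length (slot n f (lab D p) i)"
  using p by (simp only: grand_child_in_labeled_nodes subtree_D(1)[OF p] grand_child_in_decode simp_thms)

private lemma lab_grand_child_D:
  assumes p: "p @ [i, j] \<in> labeled_nodes D"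
  shows "lab D (p @ [i, j]) = slot n f (lab D p) i ! j" "j < length (slot n f (lab D p) i)"
    "f (lab D (p @ [i, j])) = (lab D p, i)" "lab D p < lab D (p @ [i, j])"
proof -
  have q: "p \<in> labeled_nodes D" using p grand_child_in_labeled_nodes by blast
  then have ij: "i < k" "j < length (slot n f (lab D p) i)" using grand_child_D p by auto
  have "subtree D (p @ [i, j]) = decode k n f (slot n f (lab D p) i ! j)"
    using grand_child_of_decode[OF ij] subtree_D(1)[OF q] by simp
  then show l: "lab D (p @ [i, j]) = slot n f (lab D p) i ! j" by (simp add: node_label_def)
  show "j < length (slot n f (lab D p) i)" by fact
  show "f (lab D (p @ [i, j])) = (lab D p, i)" "lab D p < lab D (p @ [i, j])"
    unfolding l using nth_mem[OF ij(2)] by (auto simp: set_slot)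
qed

lemma encodes_decode: "encodes (decode k n f 1) f"
  unfolding encodes_def by (intro allI impI lab_grand_child_D(3))

text \<open>The label fixes, through \<open>f\<close>, the label of the grand parent and the
  position \<open>i\<close>; induction identifies the grand parents, and distinctness of the slot
  fixes \<open>j\<close>.\<close>

private lemma inj_lab_D: "p \<in> labeled_nodes D \<Longrightarrow> q \<in> labeled_nodes D \<Longrightarrow> lab D p = lab D q \<Longrightarrow> p = q"
proof (induction "lab D p" arbitrary: p q rule: less_induct)
  case less
  have root: "lab D [] = 1" by (simp add: node_label_def)
  show ?case
  proof (cases "p = [] \<or> q = []")
    case True
    then show ?thesis using subtree_D(4)[OF less.prems(1)] subtree_D(4)[OF less.prems(2)] less.prems(3) root
      by (metis less_irrefl)
  next
    case False
    obtain p' i j where p: "p = p' @ [i, j]" "p' \<in> labeled_nodes D"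
      using less.prems(1) False labeled_nodes_cases by metis
    obtain q' i' j' where q: "q = q' @ [i', j']" "q' \<in> labeled_nodes D"
      using less.prems(2) False labeled_nodes_cases by metis
    note lp = lab_grand_child_D[OF less.prems(1)[unfolded p(1)]]
    note lq = lab_grand_child_D[OF less.prems(2)[unfolded q(1)]]
    have e: "lab D p' = lab D q'" "i = i'" using lp(3) lq(3) less.prems(3) p q by auto
    have "p' = q'" by (rule less.hyps) (use lp(4) p q e in auto)
    moreover have "j = j'"
      using lp(1,2) lq(1,2) less.prems(3) p(1) q(1) e sorted_distinct_slot(2)[of n f "lab D p'" i]
      by (metis nth_eq_iff_index_eq)
    ultimately show ?thesis using p q e by simp
  qed
qed

text \<open>Strong induction: the smaller label \<open>fst (f v)\<close> already occurs, and
  \<open>v\<close> appears in one of its slots.\<close>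

private lemma surj_lab_D: "v \<in> {1..n} \<Longrightarrow> \<exists>p\<in>labeled_nodes D. lab D p = v"
proof (induction v rule: less_induct)
  case (less v)
  show ?case
  proof (cases "v = 1")
    case True
    then show ?thesis by (intro bexI[of _ "[]"]) (auto simp: node_label_def)
  next
    case False
    then have v: "v \<in> {2..n}" using less.prems by auto
    note fv = encodings_apply[OF f v]
    obtain p where p: "p \<in> labeled_nodes D" "lab D p = fst (f v)"
      using less.IH[of "fst (f v)"] fv v by auto
    have "v \<in> set (slot n f (lab D p) (snd (f v)))" using fv v p by (auto simp: set_slot)
    then obtain j where j: "j < length (slot n f (lab D p) (snd (f v)))"
      "slot n f (lab D p) (snd (f v)) ! j = v" by (auto simp: in_set_conv_nth)
    then have q: "p @ [snd (f v), j] \<in> labeled_nodes D" using grand_child_D[OF p(1)] fv by simp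
    show ?thesis by (rule bexI[OF _ q]) (simp only: lab_grand_child_D(1)[OF q] j(2))
  qed
qed

lemma decode_in_inc_trees: "decode k n f 1 \<in> inc_trees k n"
  unfolding inc_trees_def
proof (intro CollectI conjI)
  have "leaf_or_full k (decode k n f v)" for v
    by (auto simp: leaf_or_full_def children_decode[of k n f v])
  then show "pruned_even_kary k (shape D)"
    using subtree_D(1) unfolding pruned_even_kary_shape labeled_nodes_def by (metis (mono_tags, lifting) mem_Collect_eq)
  show "\<forall>p\<in>nodes D. odd (level p) \<longrightarrow> node_label D p = None"
  proof (intro ballI impI)
    fix p assume p: "p \<in> nodes D" "odd (level p)"
    then obtain q i where q: "p = q @ [i]" by (metis even_zero list.size(3) rev_exhaust)
    then have "q \<in> labeled_nodes D" using p by (auto simp: labeled_nodes_def)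
    from subtree_D(1)[OF this] have "subtree D p = children (decode k n f (lab D q)) ! i"
      "i < length (children (decode k n f (lab D q)))" using q p by auto
    then show "node_label D p = None"
      unfolding node_label_def using root_label_child_decode by metis
  qed
  show "bij_betw (node_label D) (labeled_nodes D) (Some ` {1..n})"
    unfolding bij_betw_def
  proof
    show "inj_on (node_label D) (labeled_nodes D)" using inj_lab_D by (auto intro!: inj_onI)
    show "node_label D ` labeled_nodes D = Some ` {1..n}"
    proof (intro equalityI subsetI)
      fix y assume "y \<in> node_label D ` labeled_nodes D"
      then show "y \<in> Some ` {1..n}" using subtree_D(2,3) by blast
    next
      fix y assume "y \<in> Some ` {1..n}"
      then obtain v where "y = Some v" "v \<in> {1..n}" by auto
      then show "y \<in> node_label D ` labeled_nodes D" using surj_lab_D subtree_D(2) by force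
    qed
  qed
  show "\<forall>p q. p \<in> labeled_nodes D \<and> p @ q \<in> labeled_nodes D \<and> q \<noteq> [] \<longrightarrow> lab D p < lab D (p @ q)"
  proof (intro allI impI, elim conjE)
    fix p q assume p: "p \<in> labeled_nodes D" "p @ q \<in> labeled_nodes D" "q \<noteq> []"
    have "q \<in> nodes (decode k n f (lab D p))" "even (length q)"
      using p subtree_D(1)[OF p(1)] by (auto simp: labeled_nodes_def)
    moreover have "lab D p \<le> n" using subtree_D(3)[OF p(1)] by simp
    ultimately obtain w where "subtree (decode k n f (lab D p)) q = decode k n f w" "lab D p < w"
      using subtree_decode p(3) by blast
    then show "lab D p < lab D (p @ q)" using subtree_D(1)[OF p(1)] by (simp add: node_label_def)
  qed
  show "\<forall>p i j. i < j \<and> p @ [i] \<in> labeled_nodes D \<and> p @ [j] \<in> labeled_nodes D \<longrightarrow>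
      lab D (p @ [i]) < lab D (p @ [j])"
  proof (intro allI impI, elim conjE)
    fix p i j assume h: "i < j" "p @ [i] \<in> labeled_nodes D" "p @ [j] \<in> labeled_nodes D"
    have "p \<noteq> []" using h(2) by (auto simp: labeled_nodes_def)
    then obtain q a where q: "p = q @ [a]" by (metis rev_exhaust)
    then have a: "q @ [a, i] \<in> labeled_nodes D" "q @ [a, j] \<in> labeled_nodes D" using h by auto
    have "sorted_wrt (<) (slot n f (lab D q) a)"
      using sorted_distinct_slot by (simp add: strict_sorted_iff)
    then show "lab D (p @ [i]) < lab D (p @ [j])"
      using lab_grand_child_D(1,2)[OF a(1)] lab_grand_child_D(1,2)[OF a(2)] h(1) q
      by (simp add: sorted_wrt_iff_nth_less)
  qed
qed

end

text \<open>Injective because a tree determines the value of any encoding of it at each non-root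
  label; surjective because every tree has an encoding, from which \<open>subtree_eq_decode\<close>
  recovers it at the root.\<close>

lemma bij_betw_decode:
  assumes n: "n \<ge> 1"
  shows "bij_betw (\<lambda>f. decode k n f 1) (encodings k n) (inc_trees k n)"
  unfolding bij_betw_def
proof
  show "inj_on (\<lambda>f. decode k n f 1) (encodings k n)"
  proof (rule inj_onI)
    fix f g assume f: "f \<in> encodings k n" and g: "g \<in> encodings k n" and eq: "decode k n f 1 = decode k n g 1"
    let ?T = "decode k n f 1"
    have T: "?T \<in> inc_trees k n" by (rule decode_in_inc_trees[OF n f])
    have ef: "encodes ?T f" and eg: "encodes ?T g"
      using encodes_decode[OF n f] encodes_decode[OF n g] eq by auto
    show "f = g"
    proof (rule PiE_ext[OF f[unfolded encodings_def] g[unfolded encodings_def]])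
      fix w assume "w \<in> {2..n}"
      then obtain q i j where "q @ [i, j] \<in> labeled_nodes ?T" "lab ?T (q @ [i, j]) = w"
        using grand_child_of_label[OF T] by blast
      then show "f w = g w" using encodesD[OF T ef] encodesD[OF T eg] by metis
    qed
  qed
  show "(\<lambda>f. decode k n f 1) ` encodings k n = inc_trees k n"
  proof
    show "(\<lambda>f. decode k n f 1) ` encodings k n \<subseteq> inc_trees k n" using decode_in_inc_trees[OF n] by blast
    show "inc_trees k n \<subseteq> (\<lambda>f. decode k n f 1) ` encodings k n"
    proof
      fix T assume T: "T \<in> inc_trees k n"
      then obtain f where f: "f \<in> encodings k n" "encodes T f" using exists_encoding by blast
      have "T = decode k n f 1" using subtree_eq_decode[OF T f(2), of "[]"] lab_root[OF T] by simp
      then show "T \<in> (\<lambda>f. decode k n f 1) ` encodings k n" using f by blast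
    qed
  qed
qed

section \<open>Transfer of the leaf statistics to trees, and the expansion\<close>

lemma sum_inc_trees:
  assumes n: "n \<ge> 2"
  shows "(\<Sum>T\<in>inc_trees k n. g (lleaf T) (card (young_leaves T))) =
    (\<Sum>f\<in>encodings k n. g (card (old_leaf_labels n f) + card (young_leaf_labels n f)) (card (young_leaf_labels n f)))"
proof -
  have n1: "n \<ge> 1" using n by simp
  show ?thesis
    unfolding sum.reindex_bij_betw[OF bij_betw_decode[OF n1], symmetric]
  proof (rule sum.cong[OF refl])
    fix f assume f: "f \<in> encodings k n"
    note T = decode_in_inc_trees[OF n1 f] and e = encodes_decode[OF n1 f]
    show "g (lleaf (decode k n f 1)) (card (young_leaves (decode k n f 1))) =
      g (card (old_leaf_labels n f) + card (young_leaf_labels n f)) (card (young_leaf_labels n f))"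
      unfolding lleaf_eq[OF T e n f] card_young_leaves[OF T e] ..
  qed
qed

lemma finite_inc_trees: "n \<ge> 1 \<Longrightarrow> finite (inc_trees k n)"
  using bij_betw_finite[OF bij_betw_decode[of n k]] by simp

lemma finite_young_leaves:
  assumes "T \<in> inc_trees k n" shows "finite (young_leaves T)"
proof -
  have "finite (labeled_nodes T)" using bij_betw_finite[OF bij_lab[OF assms]] by simp
  then show ?thesis by (rule rev_finite_subset) (auto simp: young_leaves_def labeled_leaves_def)
qed

text \<open>Apply \<open>sum_leaf_labels\<close> to the indicator function of the pair
  \<open>(i, 0)\<close>.\<close>

lemma gamma_tilde_eq:
  assumes n: "n \<ge> 2" and i: "i \<le> n"
  shows "gamma_tilde n k i = gamma_rec k n i"
proof -
  have fin: "finite (inc_trees k n)" using n by (intro finite_inc_trees) simp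
  have "gamma_tilde n k i = (\<Sum>T\<in>inc_trees k n. if lleaf T = i \<and> young_leaves T = {} then 1 else 0)"
    using fin by (simp add: gamma_tilde_def sum.If_cases Int_def)
  also have "\<dots> = (\<Sum>T\<in>inc_trees k n. (\<lambda>l j. if l = i \<and> j = 0 then 1 else 0) (lleaf T) (card (young_leaves T)))"
    by (rule sum.cong) (auto simp: finite_young_leaves)
  \<comment> \<open>Without young leaves, the number of leaves is the number of old leaves.\<close>
  also have "\<dots> = (\<Sum>f\<in>encodings k n. (\<lambda>l j. if l = i \<and> j = 0 then 1 else 0)
      (card (old_leaf_labels n f)) (card (young_leaf_labels n f)))"
    unfolding sum_inc_trees[OF n, where g = "\<lambda>l j. if l = i \<and> j = 0 then 1 else 0"]
    by (rule sum.cong) auto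
  also have "\<dots> = (\<Sum>l\<le>n. of_nat (gamma_rec k n l) *
      binomial_sum (n - 2 * l) (\<lambda>j. if l = i \<and> j = 0 then 1 else 0))"
    by (rule sum_leaf_labels[OF n])
  \<comment> \<open>Only \<open>l = i\<close> and \<open>j = 0\<close> contribute, with binomial
    coefficient one.\<close>
  also have "\<dots> = (\<Sum>l\<le>n. if l = i then gamma_rec k n i else 0)"
    by (rule sum.cong) (auto simp: binomial_sum_def if_distrib cong: if_cong)
  finally show ?thesis using i by simp
qed

theorem theorem4p1:
  fixes n k :: nat
  assumes "n \<ge> 2" and "k \<ge> 1"
  shows "c_poly k n = (\<Sum>T\<in>inc_trees k n. monom 1 (lleaf T)) \<and>
         (\<Sum>T\<in>inc_trees k n. monom (1::int) (lleaf T)) =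
           (\<Sum>i = 1..n div 2. of_nat (gamma_tilde n k i) * monom 1 i * (1 + monom 1 1) ^ (n - 2 * i))"
proof
  have trees: "(\<Sum>T\<in>inc_trees k n. monom (1::int) (lleaf T)) =
      (\<Sum>f\<in>encodings k n. monom 1 (card (old_leaf_labels n f) + card (young_leaf_labels n f)))"
    by (rule sum_inc_trees[OF assms(1), where g = "\<lambda>l _. monom 1 l"])
  then show "c_poly k n = (\<Sum>T\<in>inc_trees k n. monom 1 (lleaf T))"
    unfolding c_poly_def using sum_leaf_labels_eq_Qtilde[OF assms, of "monom (1::int)"] by simp
  \<comment> \<open>Old and young leaves both get weight \<open>x\<close>, so
    \<open>sum_leaf_labels\<close> is used with \<open>x ^ (i + j)\<close> as
    \<open>g i j\<close>.\<close>
  have "(\<Sum>T\<in>inc_trees k n. monom (1::int) (lleaf T)) =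
      (\<Sum>i\<le>n. of_nat (gamma_rec k n i) * binomial_sum (n - 2 * i) (\<lambda>j. monom 1 (i + j)))"
    unfolding trees by (rule sum_leaf_labels[OF assms(1)])
  \<comment> \<open>The coefficients for \<open>i = 0\<close> and for \<open>2 * i > n\<close>
    vanish.\<close>
  also have "\<dots> = (\<Sum>i = 1..n div 2. of_nat (gamma_rec k n i) * binomial_sum (n - 2 * i) (\<lambda>j. monom 1 (i + j)))"
    by (rule sum.mono_neutral_right) (auto simp: gamma_rec_eq_0 not_le)
  also have "\<dots> = (\<Sum>i = 1..n div 2. of_nat (gamma_tilde n k i) * monom 1 i * (1 + monom 1 1) ^ (n - 2 * i))"
  proof (rule sum.cong[OF refl])
    fix i assume "i \<in> {1..n div 2}"
    then have "gamma_tilde n k i = gamma_rec k n i" using assms by (intro gamma_tilde_eq) auto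
    \<comment> \<open>With \<open>x ^ j\<close> in place of \<open>v ^ j\<close> the functional is
      the binomial theorem.\<close>
    moreover have "binomial_sum a (\<lambda>j. monom (1::int) (i + j)) = monom 1 i * (1 + monom 1 1) ^ a" for a
    proof -
      have "(1 + monom (1::int) 1) ^ a = (\<Sum>j\<le>a. of_nat (a choose j) * monom 1 j)"
        by (subst add.commute) (simp add: binomial_ring monom_power)
      moreover have "monom (1::int) (i + j) = monom 1 i * monom 1 j" for j by (simp add: mult_monom)
      ultimately show ?thesis by (simp only: binomial_sum_def sum_distrib_left mult.left_commute)
    qed
    ultimately show "of_nat (gamma_rec k n i) * binomial_sum (n - 2 * i) (\<lambda>j. monom (1::int) (i + j)) =
        of_nat (gamma_tilde n k i) * monom 1 i * (1 + monom 1 1) ^ (n - 2 * i)"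
      by (simp add: mult.assoc)
  qed
  finally show "(\<Sum>T\<in>inc_trees k n. monom (1::int) (lleaf T)) =
      (\<Sum>i = 1..n div 2. of_nat (gamma_tilde n k i) * monom 1 i * (1 + monom 1 1) ^ (n - 2 * i))" .
qed

end
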